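(* Let $K\geq 3$, let $D=\{d_1,\ldots,d_K\}$ be a set with $K$ elements, and let $\pi,\nu>0$ and $\alpha_1,\ldots,\alpha_{K-2}>0$ be real numbers with $\sum_{i=1}^{K-2}\alpha_i<1$. Let $\mathbf{X}_{[1,\infty)}=\{X_n:n\geq 1\}$ be an $HLS_K(\pi,\nu,\alpha_1,\ldots,\alpha_{K-2})$ exchangeable sequence with values in $D$. Then $\mathbf{X}_{[1,\infty)}$ is Hoeffding decomposable, and it is neither an i.i.d. sequence nor a $K$-color Pólya sequence.
   Context: **Exchangeability and de Finetti measure.** A sequence $\mathbf{X}_{[1,\infty)}=\{X_n:n\ge 1\}$ of $D$-valued random variables, $D=\{d_1,\ldots,d_K\}$, is exchangeable if for every $n\geq 2$, every $(x_1,\ldots,x_n)\in D^n$ and every permutation $\sigma$ of $\{1,\ldots,n\}$, $\mathbb{P}(X_1=x_1,\ldots,X_n=x_n)=\mathbb{P}(X_1=x_{\sigma(1)},\ldots,X_n=x_{\sigma(n)})$. Let $$\Theta_{K-1}=\Big\{(\theta_1,\ldots,\theta_{K-1}):\theta_h\geq 0,\ \sum_{h=1}^{K-1}\theta_h\leq 1\Big\}.$$ By de Finetti's theorem, $\mathbf{X}_{[1,\infty)}$ is exchangeable if and only if there is a (unique) probability measure $\gamma$ on $\Theta_{K-1}$, called its de Finetti measure, such that for all $n$ and all $(x_1,\ldots,x_n)\in D^n$, $$\mathbb{P}(X_1=x_1,\ldots,X_n=x_n)=\int_{\Theta_{K-1}}\Big(\prod_{j=1}^{K-1}\theta_j^{i_j}\Big)\Big(1-\sum_{h=1}^{K-1}\theta_h\Big)^{i_K}\gamma(d\theta_1,\ldots,d\theta_{K-1}),$$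 where $i_j=\sum_{v=1}^n\mathbf{1}(x_v=d_j)$, $j=1,\ldots,K$. **Pólya sequences.** The exchangeable sequence $\mathbf{X}_{[1,\infty)}$ is a $K$-color Pólya sequence if there is $(a_1,\ldots,a_K)\in(0,+\infty)^K$ such that $\gamma$ is the Dirichlet probability measure $$\gamma(d\theta_1,\ldots,d\theta_{K-1})=\frac{\Gamma(\sum_{j=1}^K a_j)}{\prod_{j=1}^K\Gamma(a_j)}\Big(\prod_{j=1}^{K-1}\theta_j^{a_j-1}\Big)\Big(1-\sum_{h=1}^{K-1}\theta_h\Big)^{a_K-1}d\theta_1\cdots d\theta_{K-1}.$$ **HLS sequences.** For $K\geq 3$, $\pi,\nu>0$ and $\alpha_1,\ldots,\alpha_{K-2}>0$ with $\sum_{i=1}^{K-2}\alpha_i<1$, an $HLS_K(\pi,\nu,\alpha_1,\ldots,\alpha_{K-2})$ exchangeable sequence is an exchangeable sequence with values in $D=\{d_1,\ldots,d_K\}$ whose de Finetti measure is $$\gamma(d\theta_1,\ldots,d\theta_{K-1})=\frac{1}{B(\pi,\nu)}\,\delta_{\alpha_1(1-\theta_1)}(d\theta_2)\cdots\delta_{\alpha_{K-2}(1-\theta_1)}(d\theta_{K-1})\,\theta_1^{\pi-1}(1-\theta_1)^{\nu-1}d\theta_1,$$ where $\theta_1$ ranges over $[0,1]$, $B(\pi,\nu)=\Gamma(\pi)\Gamma(\nu)/\Gamma(\pi+\nu)$ and $\delta_x$ is the Dirac mass at $x$. **Hoeffding decomposability.** Write $\mathbf{X}_{[n]}=(X_1,\ldots,X_n)$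 and $\mathbf{X}_{[u,n]}=(X_u,\ldots,X_n)$. Let $L_s(\mathbf{X}_{[n]})$ be the Hilbert space of all real random variables $T(\mathbf{X}_{[n]})$ with $T:D^n\to\mathbb{R}$ symmetric, with inner product $\langle T_1,T_2\rangle=\mathbb{E}(T_1(\mathbf{X}_{[n]})T_2(\mathbf{X}_{[n]}))$. Let $SU_0(\mathbf{X}_{[n]})=\mathbb{R}$ and, for $k=1,\ldots,n$, let $SU_k(\mathbf{X}_{[n]})$ be the set of all random variables of the form $$F(\mathbf{X}_{[n]})=\sum_{1\leq j_1<\cdots<j_k\leq n}\varphi(X_{j_1},\ldots,X_{j_k}),$$ with $\varphi:D^k\to\mathbb{R}$ symmetric (the kernel of $F$). These spaces increase with $k$ and $SU_n(\mathbf{X}_{[n]})=L_s(\mathbf{X}_{[n]})$. Set $SH_0(\mathbf{X}_{[n]})=\mathbb{R}$ and $SH_k(\mathbf{X}_{[n]})=SU_k(\mathbf{X}_{[n]})\cap SU_{k-1}(\mathbf{X}_{[n]})^{\perp}$ for $k=1,\ldots,n$, with orthogonals taken in $L_s(\mathbf{X}_{[n]})$. The exchangeable sequence $\mathbf{X}_{[1,\infty)}$ is Hoeffding decomposable if for all $n\geq 2$ and all $k=1,\ldots,n$ the following equivalence holds: a random variable $F_k=\sum_{1\leq i_1<\cdots<i_k\leq n}\varphi_k(X_{i_1},\ldots,X_{i_k})$, with $\varphi_k:D^k\to\mathbb{R}$ symmetric, belongs to $SH_k(\mathbf{X}_{[n]})$ if and only if $\varphi_k$ is completely degenerate, i.e.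 $\mathbb{E}(\varphi_k(\mathbf{X}_{[k]})\mid\mathbf{X}_{[2,k]})=0$ almost surely (for $k=1$ this means $\mathbb{E}(\varphi_1(X_1))=0$). *)

theory Defs
  imports "HOL-Probability.Probability" "HOL-Combinatorics.Permutations"
begin

text \<open>
  Sequences are indexed by the naturals \<open>n \<ge> 1\<close>; the value \<open>X 0\<close> is never used.
  Elements of \<open>D\<^sup>n\<close> are lists of length \<open>n\<close>, hence their positions (and the permutations
  acting on them) are numbered \<open>0, \<dots>, n - 1\<close>.
\<close>

definition tuples :: "'d set \<Rightarrow> nat \<Rightarrow> 'd list set" where
  "tuples D n = {xs. length xs = n \<and> set xs \<subseteq> D}"

text \<open>\<open>block X m n\<close> is the random vector \<open>(X\<^sub>m, \<dots>, X\<^sub>n)\<close>, empty if \<open>n < m\<close>.\<close>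

definition block :: "(nat \<Rightarrow> 'w \<Rightarrow> 'd) \<Rightarrow> nat \<Rightarrow> nat \<Rightarrow> 'w \<Rightarrow> 'd list" where
  "block X m n \<omega> = map (\<lambda>i. X i \<omega>) [m..<Suc n]"


section \<open>Exchangeability and de Finetti measures\<close>

definition exchangeable :: "'w measure \<Rightarrow> 'd set \<Rightarrow> (nat \<Rightarrow> 'w \<Rightarrow> 'd) \<Rightarrow> bool" where
  "exchangeable M D X \<longleftrightarrow>
    (\<forall>n\<ge>2. \<forall>xs\<in>tuples D n. \<forall>\<sigma>. \<sigma> permutes {..<n} \<longrightarrow>
      measure M {\<omega>\<in>space M. block X 1 n \<omega> = xs} =
      measure M {\<omega>\<in>space M. block X 1 n \<omega> = permute_list \<sigma> xs})"

text \<open>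
  A point of \<open>\<real>\<^bsup>K-1\<^esup>\<close> is an extensional function on \<open>{1..K-1}\<close>.
\<close>

definition Theta :: "nat \<Rightarrow> (nat \<Rightarrow> real) set" where
  "Theta K = {\<theta> \<in> {1..K-1} \<rightarrow>\<^sub>E UNIV. (\<forall>h\<in>{1..K-1}. \<theta> h \<ge> 0) \<and> (\<Sum>h=1..K-1. \<theta> h) \<le> 1}"

definition Theta_borel :: "nat \<Rightarrow> (nat \<Rightarrow> real) measure" where
  "Theta_borel K = restrict_space (PiM {1..K-1} (\<lambda>_. borel)) (Theta K)"

definition Theta_lborel :: "nat \<Rightarrow> (nat \<Rightarrow> real) measure" where
  "Theta_lborel K = restrict_space (PiM {1..K-1} (\<lambda>_. lborel)) (Theta K)"

text \<open>
  The colours are \<open>d 1, \<dots>, d K\<close>. The representing measure of an exchangeable sequence is unique,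
  so this predicate says that \<open>\<gamma>\<close> is the de Finetti measure of \<open>X\<close>.
\<close>

definition de_Finetti_measure ::
    "'w measure \<Rightarrow> nat \<Rightarrow> (nat \<Rightarrow> 'd) \<Rightarrow> (nat \<Rightarrow> 'w \<Rightarrow> 'd) \<Rightarrow> (nat \<Rightarrow> real) measure \<Rightarrow> bool" where
  "de_Finetti_measure M K d X \<gamma> \<longleftrightarrow>
    prob_space \<gamma> \<and> sets \<gamma> = sets (Theta_borel K) \<and>
    (\<forall>n\<ge>1. \<forall>xs\<in>tuples (d ` {1..K}) n.
      measure M {\<omega>\<in>space M. block X 1 n \<omega> = xs} =
      (\<integral>\<theta>. (\<Prod>j=1..K-1. \<theta> j ^ count_list xs (d j)) *
            (1 - (\<Sum>h=1..K-1. \<theta> h)) ^ count_list xs (d K) \<partial>\<gamma>))"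


section \<open>Special classes of sequences\<close>

definition iid_sequence :: "'w measure \<Rightarrow> 'd set \<Rightarrow> (nat \<Rightarrow> 'w \<Rightarrow> 'd) \<Rightarrow> bool" where
  "iid_sequence M D X \<longleftrightarrow>
    prob_space.indep_vars M (\<lambda>_. count_space D) X {1..} \<and>
    (\<forall>n\<ge>1. distr M (count_space D) (X n) = distr M (count_space D) (X 1))"

definition Dirichlet_measure :: "nat \<Rightarrow> (nat \<Rightarrow> real) \<Rightarrow> (nat \<Rightarrow> real) measure" where
  "Dirichlet_measure K a = density (Theta_lborel K) (\<lambda>\<theta>. ennreal (
      Gamma (\<Sum>j=1..K. a j) / (\<Prod>j=1..K. Gamma (a j)) *
      (\<Prod>j=1..K-1. \<theta> j powr (a j - 1)) * (1 - (\<Sum>h=1..K-1. \<theta> h)) powr (a K - 1)))"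

definition Polya_sequence ::
    "'w measure \<Rightarrow> nat \<Rightarrow> (nat \<Rightarrow> 'd) \<Rightarrow> (nat \<Rightarrow> 'w \<Rightarrow> 'd) \<Rightarrow> bool" where
  "Polya_sequence M K d X \<longleftrightarrow>
    exchangeable M (d ` {1..K}) X \<and>
    (\<exists>a. (\<forall>j\<in>{1..K}. a j > 0) \<and> de_Finetti_measure M K d X (Dirichlet_measure K a))"

text \<open>
  Integrating out the Dirac masses
  \<open>\<delta>\<^bsub>\<alpha> 1 (1-\<theta> 1)\<^esub>(d\<theta> 2) \<dots> \<delta>\<^bsub>\<alpha> (K-2) (1-\<theta> 1)\<^esub>(d\<theta> (K-1))\<close> leaves the image of the Beta law of \<open>\<theta> 1\<close>
  under \<open>t \<mapsto> (t, \<alpha> 1 (1-t), \<dots>, \<alpha> (K-2) (1-t))\<close>.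
\<close>

definition HLS_measure ::
    "nat \<Rightarrow> real \<Rightarrow> real \<Rightarrow> (nat \<Rightarrow> real) \<Rightarrow> (nat \<Rightarrow> real) measure" where
  "HLS_measure K \<pi> \<nu> \<alpha> =
    distr
      (density (restrict_space lborel {0..1})
        (\<lambda>t. ennreal (1 / Beta \<pi> \<nu> * t powr (\<pi> - 1) * (1 - t) powr (\<nu> - 1))))
      (Theta_borel K)
      (\<lambda>t. \<lambda>j\<in>{1..K-1}. if j = 1 then t else \<alpha> (j - 1) * (1 - t))"

definition HLS_sequence ::
    "'w measure \<Rightarrow> nat \<Rightarrow> (nat \<Rightarrow> 'd) \<Rightarrow> real \<Rightarrow> real \<Rightarrow> (nat \<Rightarrow> real) \<Rightarrow> (nat \<Rightarrow> 'w \<Rightarrow> 'd) \<Rightarrow> bool" where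
  "HLS_sequence M K d \<pi> \<nu> \<alpha> X \<longleftrightarrow>
    exchangeable M (d ` {1..K}) X \<and> de_Finetti_measure M K d X (HLS_measure K \<pi> \<nu> \<alpha>)"


section \<open>Hoeffding decomposability\<close>

definition symmetric_fun :: "'d set \<Rightarrow> nat \<Rightarrow> ('d list \<Rightarrow> real) \<Rightarrow> bool" where
  "symmetric_fun D k \<phi> \<longleftrightarrow>
    (\<forall>xs\<in>tuples D k. \<forall>\<sigma>. \<sigma> permutes {..<k} \<longrightarrow> \<phi> (permute_list \<sigma> xs) = \<phi> xs)"

text \<open>
  The increasing index tuples \<open>j\<^sub>1 < \<dots> < j\<^sub>k\<close> in \<open>{1..n}\<close> are the sorted enumerations of the
  \<open>k\<close>-element subsets.
\<close>

definition U_stat :: "(nat \<Rightarrow> 'w \<Rightarrow> 'd) \<Rightarrow> nat \<Rightarrow> nat \<Rightarrow> ('d list \<Rightarrow> real) \<Rightarrow> 'w \<Rightarrow> real" where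
  "U_stat X n k \<phi> \<omega> =
    (\<Sum>J | J \<subseteq> {1..n} \<and> card J = k. \<phi> (map (\<lambda>j. X j \<omega>) (sorted_list_of_set J)))"

text \<open>
  As elements of a Hilbert space, random variables that agree almost surely are identified; the
  spaces below are therefore saturated under almost sure equality.
\<close>

definition L_s :: "'w measure \<Rightarrow> 'd set \<Rightarrow> (nat \<Rightarrow> 'w \<Rightarrow> 'd) \<Rightarrow> nat \<Rightarrow> ('w \<Rightarrow> real) set" where
  "L_s M D X n = {F \<in> borel_measurable M.
    \<exists>T. symmetric_fun D n T \<and> (AE \<omega> in M. F \<omega> = T (block X 1 n \<omega>))}"

definition SU :: "'w measure \<Rightarrow> 'd set \<Rightarrow> (nat \<Rightarrow> 'w \<Rightarrow> 'd) \<Rightarrow> nat \<Rightarrow> nat \<Rightarrow> ('w \<Rightarrow> real) set" where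
  "SU M D X n k =
    (if k = 0 then {F \<in> borel_measurable M. \<exists>c. AE \<omega> in M. F \<omega> = c}
     else {F \<in> borel_measurable M.
       \<exists>\<phi>. symmetric_fun D k \<phi> \<and> (AE \<omega> in M. F \<omega> = U_stat X n k \<phi> \<omega>)})"

definition orth_compl ::
    "'w measure \<Rightarrow> 'd set \<Rightarrow> (nat \<Rightarrow> 'w \<Rightarrow> 'd) \<Rightarrow> nat \<Rightarrow> ('w \<Rightarrow> real) set \<Rightarrow> ('w \<Rightarrow> real) set" where
  "orth_compl M D X n S = {F \<in> L_s M D X n. \<forall>G\<in>S. (\<integral>\<omega>. F \<omega> * G \<omega> \<partial>M) = 0}"

definition SH :: "'w measure \<Rightarrow> 'd set \<Rightarrow> (nat \<Rightarrow> 'w \<Rightarrow> 'd) \<Rightarrow> nat \<Rightarrow> nat \<Rightarrow> ('w \<Rightarrow> real) set" where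
  "SH M D X n k =
    (if k = 0 then SU M D X n 0
     else SU M D X n k \<inter> orth_compl M D X n (SU M D X n (k - 1)))"

definition completely_degenerate ::
    "'w measure \<Rightarrow> 'd set \<Rightarrow> (nat \<Rightarrow> 'w \<Rightarrow> 'd) \<Rightarrow> nat \<Rightarrow> ('d list \<Rightarrow> real) \<Rightarrow> bool" where
  "completely_degenerate M D X k \<phi> \<longleftrightarrow>
    (if k = 1 then (\<integral>\<omega>. \<phi> (block X 1 1 \<omega>) \<partial>M) = 0
     else AE \<omega> in M.
       real_cond_exp M (vimage_algebra (space M) (block X 2 k) (count_space (tuples D (k - 1))))
         (\<lambda>\<omega>. \<phi> (block X 1 k \<omega>)) \<omega> = 0)"

definition Hoeffding_decomposable ::
    "'w measure \<Rightarrow> 'd set \<Rightarrow> (nat \<Rightarrow> 'w \<Rightarrow> 'd) \<Rightarrow> bool" where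
  "Hoeffding_decomposable M D X \<longleftrightarrow>
    (\<forall>n\<ge>2. \<forall>k\<in>{1..n}. \<forall>\<phi>. symmetric_fun D k \<phi> \<longrightarrow>
      (U_stat X n k \<phi> \<in> SH M D X n k \<longleftrightarrow> completely_degenerate M D X k \<phi>))"

end

theory Submission
  imports Defs
begin

text \<open>
  An HLS sequence is a two-colour Polya urn deciding whether a term equals \<open>c\<^sub>0 = d\<^sub>1\<close>, refined by
  independent draws of the other colours. The probability of a word is therefore a product of colour
  weights times a ratio of Pochhammer symbols in the number of \<open>c\<^sub>0\<close>.

  A kernel is completely degenerate iff its product with this probability has vanishing
  marginals. Given \<open>X\<^sub>J\<close>, the law of the \<open>|I - J|\<close> remaining coordinates of \<open>X\<^sub>I\<close> is a polynomial
  of degree \<open>|I - J|\<close> in the number of \<open>c\<^sub>0\<close>. For \<open>|J| = k = |I| + 1\<close> this degree is less than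
  \<open>|J - I|\<close>, so iterated differences annihilate the polynomial and \<open>\<phi>(X\<^sub>J)\<close> is orthogonal to
  \<open>\<psi>(X\<^sub>I)\<close>: degenerate kernels give elements of \<open>SH\<^sub>k\<close>. Conversely, projecting a kernel onto the
  lifts of kernels of order \<open>k - 1\<close> splits it into a degenerate part and a lift; if the statistic is in
  \<open>SH\<^sub>k\<close>, the statistic of the lift is orthogonal to itself, and the lift vanishes because
  U-statistics determine their kernels.

  The sequence is not i.i.d., as the first two terms are positively correlated, and not a Polya
  sequence, as its de Finetti measure lives on a hyperplane, which Dirichlet measures do not charge.
\<close>


section \<open>Finite differences and vanishing marginals\<close>

text \<open>On the naturals this says that \<open>q\<close> is a polynomial of degree below
  \<open>n\<close>. The encoding by iterated differences matches the summation argument, which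
  spends one difference per coordinate.\<close>

primrec degree_less :: "nat \<Rightarrow> (nat \<Rightarrow> real) \<Rightarrow> bool" where
  "degree_less 0 q \<longleftrightarrow> (\<forall>m. q m = 0)"
| "degree_less (Suc n) q \<longleftrightarrow> degree_less n (\<lambda>m. q (Suc m) - q m)"

lemma degree_less_add:
  "degree_less n p \<Longrightarrow> degree_less n q \<Longrightarrow> degree_less n (\<lambda>m. p m + q m)"
proof (induction n arbitrary: p q)
  case (Suc n)
  have "degree_less n (\<lambda>m. (p (Suc m) - p m) + (q (Suc m) - q m))"
    using Suc.prems by (intro Suc.IH) auto
  then show ?case by (simp add: algebra_simps)
qed simp

lemma degree_less_cmult: "degree_less n q \<Longrightarrow> degree_less n (\<lambda>m. c * q m)"
proof (induction n arbitrary: q)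
  case (Suc n)
  then have "degree_less n (\<lambda>m. c * (q (Suc m) - q m))" by simp
  then show ?case by (simp add: algebra_simps)
qed simp

text \<open>Discrete Leibniz rule: the difference of the product is the difference of
  \<open>q\<close> times the affine factor at \<open>m + 1\<close>, plus \<open>e * q m\<close>. The
  shift of the affine factor is why \<open>a\<close> varies in the induction.\<close>

lemma degree_less_mult_affine:
  "degree_less n q \<Longrightarrow> degree_less (Suc n) (\<lambda>m. q m * (a + e * real m))"
proof (induction n arbitrary: q a)
  case (Suc n)
  have "degree_less (Suc n) (\<lambda>m. (q (Suc m) - q m) * ((a + e) + e * real m))"
    using Suc.prems by (intro Suc.IH) auto
  moreover have "degree_less (Suc n) (\<lambda>m. e * q m)"
    using Suc.prems by (rule degree_less_cmult)
  ultimately have "degree_less (Suc n) (\<lambda>m. (q (Suc m) - q m) * ((a + e) + e * real m) + e * q m)"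
    by (rule degree_less_add)
  also have "(\<lambda>m. (q (Suc m) - q m) * ((a + e) + e * real m) + e * q m) =
      (\<lambda>m. q (Suc m) * (a + e * real (Suc m)) - q m * (a + e * real m))"
    by (simp add: algebra_simps)
  finally show ?case by simp
qed simp

text \<open>A Pochhammer symbol is a product of \<open>i\<close> affine factors. The slope
  \<open>e\<close> stays free because both 1 and -1 occur later.\<close>

lemma degree_less_mult_pochhammer:
  assumes "degree_less n q"
  shows "degree_less (n + i) (\<lambda>m. q m * pochhammer (a + e * real m) i)"
proof (induction i)
  case (Suc i)
  have "degree_less (Suc (n + i))
      (\<lambda>m. (q m * pochhammer (a + e * real m) i) * ((a + real i) + e * real m))"
    using Suc by (rule degree_less_mult_affine)
  then show ?case by (simp add: pochhammer_Suc algebra_simps)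
qed (use assms in simp)

section \<open>Summation against functions with vanishing marginals\<close>

lemma sum_PiE_insert:
  fixes f :: "('i \<Rightarrow> 'd) \<Rightarrow> real"
  assumes "l \<notin> S"
  shows "(\<Sum>x\<in>PiE (insert l S) (\<lambda>_. D). f x) = (\<Sum>x\<in>PiE S (\<lambda>_. D). \<Sum>c\<in>D. f (x(l := c)))"
proof -
  have "(\<Sum>x\<in>PiE (insert l S) (\<lambda>_. D). f x) = (\<Sum>(c, x)\<in>D \<times> PiE S (\<lambda>_. D). f (x(l := c)))"
    using inj_combinator[OF assms, of "\<lambda>_. D"]
    by (simp add: PiE_insert_eq sum.reindex case_prod_unfold)
  also have "\<dots> = (\<Sum>c\<in>D. \<Sum>x\<in>PiE S (\<lambda>_. D). f (x(l := c)))"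
    by (simp add: sum.cartesian_product)
  also have "\<dots> = (\<Sum>x\<in>PiE S (\<lambda>_. D). \<Sum>c\<in>D. f (x(l := c)))"
    by (rule sum.swap)
  finally show ?thesis .
qed

text \<open>
  Summing out one coordinate \<open>l \<in> A\<close> replaces \<open>g x\<close> by its first difference, because the terms
  without \<open>c\<^sub>0\<close> at \<open>l\<close> recombine to a multiple of the vanishing marginal of \<open>Q\<close>.
\<close>

lemma sum_zero_marginals_polynomial:
  fixes Q :: "('i \<Rightarrow> 'd) \<Rightarrow> real" and g :: "('i \<Rightarrow> 'd) \<Rightarrow> nat \<Rightarrow> real"
  assumes "finite A" "finite D" "c\<^sub>0 \<in> D" "A \<subseteq> S"
    and "\<And>l x. l \<in> A \<Longrightarrow> x \<in> PiE S (\<lambda>_. D) \<Longrightarrow> (\<Sum>c\<in>D. Q (x(l := c))) = 0"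
    and "\<And>l x c. l \<in> A \<Longrightarrow> x \<in> PiE S (\<lambda>_. D) \<Longrightarrow> c \<in> D \<Longrightarrow> g (x(l := c)) = g x"
    and "\<And>x. x \<in> PiE S (\<lambda>_. D) \<Longrightarrow> degree_less (card A) (g x)"
  shows "(\<Sum>x\<in>PiE S (\<lambda>_. D). Q x * g x (card {i\<in>A. x i = c\<^sub>0})) = 0"
  using assms(1,4-)
proof (induction A arbitrary: S Q g rule: finite_induct)
  case empty
  then show ?case by simp
next
  case (insert l A)
  define T where "T = S - {l}"
  have S: "S = insert l T" "l \<notin> T" using insert.prems(1) by (auto simp: T_def)
  define Q' where "Q' x = Q (x(l := c\<^sub>0))" for x
  define g' where "g' x m = g (x(l := c\<^sub>0)) (Suc m) - g (x(l := c\<^sub>0)) m" for x m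
  have upd: "x(l := c) \<in> PiE S (\<lambda>_. D)" if "x \<in> PiE T (\<lambda>_. D)" "c \<in> D" for x c
    using that S by (auto simp: PiE_iff extensional_def)
  have inner: "(\<Sum>c\<in>D. Q (x(l := c)) * g (x(l := c)) (card {i\<in>insert l A. (x(l := c)) i = c\<^sub>0})) =
      Q' x * g' x (card {i\<in>A. x i = c\<^sub>0})" if x: "x \<in> PiE T (\<lambda>_. D)" for x
  proof -
    let ?G = "g (x(l := c\<^sub>0))"
    let ?a = "card {i\<in>A. x i = c\<^sub>0}"
    \<comment> \<open>Every colour is given the value \<open>?G ?a\<close> that belongs to an
      uncounted \<open>l\<close>; only \<open>c\<^sub>0\<close> needs a correction, and this is the
      first difference \<open>g'\<close>.\<close>
    have "Q (x(l := c)) * g (x(l := c)) (card {i\<in>insert l A. (x(l := c)) i = c\<^sub>0}) =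
        Q (x(l := c)) * ?G ?a + (if c = c\<^sub>0 then Q' x * g' x ?a else 0)" if c: "c \<in> D" for c
    proof -
      have eq: "g (x(l := c)) = ?G"
        using insert.prems(3)[OF _ upd[OF x \<open>c\<^sub>0 \<in> D\<close>] c, of l]
        by (simp only: fun_upd_upd insertI1)
      show ?thesis
      proof (cases "c = c\<^sub>0")
        case True
        have "{i\<in>insert l A. (x(l := c)) i = c\<^sub>0} = insert l {i\<in>A. x i = c\<^sub>0}"
          using True insert.hyps(2) by auto
        then have "card {i\<in>insert l A. (x(l := c)) i = c\<^sub>0} = Suc ?a"
          using insert.hyps by simp
        then show ?thesis
          unfolding eq using True by (simp add: g'_def Q'_def algebra_simps)
      next
        case False
        have "{i\<in>insert l A. (x(l := c)) i = c\<^sub>0} = {i\<in>A. x i = c\<^sub>0}"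
          using False insert.hyps(2) by auto
        then show ?thesis unfolding eq using False by simp
      qed
    qed
    then have "(\<Sum>c\<in>D. Q (x(l := c)) * g (x(l := c)) (card {i\<in>insert l A. (x(l := c)) i = c\<^sub>0})) =
        (\<Sum>c\<in>D. Q (x(l := c))) * ?G ?a + Q' x * g' x ?a"
      using \<open>finite D\<close> \<open>c\<^sub>0 \<in> D\<close> by (simp add: sum.distrib sum_distrib_right)
    moreover have "(\<Sum>c\<in>D. Q (x(l := c))) = 0"
      using insert.prems(2)[OF _ upd[OF x \<open>c\<^sub>0 \<in> D\<close>], of l]
      by (simp only: fun_upd_upd insertI1)
    ultimately show ?thesis by simp
  qed
  have "(\<Sum>x\<in>PiE T (\<lambda>_. D). Q' x * g' x (card {i\<in>A. x i = c\<^sub>0})) = 0"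
  proof (rule insert.IH)
    show "A \<subseteq> T" using insert.prems(1) insert.hyps(2) by (auto simp: T_def)
  next
    fix j x assume j: "j \<in> A" and x: "x \<in> PiE T (\<lambda>_. D)"
    then have ne: "j \<noteq> l" using insert.hyps(2) by auto
    have twist: "(x(j := c))(l := c\<^sub>0) = (x(l := c\<^sub>0))(j := c)" for c
      using ne by (rule fun_upd_twist)
    show "(\<Sum>c\<in>D. Q' (x(j := c))) = 0"
      unfolding Q'_def twist
      by (rule insert.prems(2)[OF _ upd[OF x \<open>c\<^sub>0 \<in> D\<close>]]) (use j in blast)
    show "g' (x(j := c)) = g' x" if "c \<in> D" for c
    proof -
      have "g ((x(l := c\<^sub>0))(j := c)) = g (x(l := c\<^sub>0))"
        by (rule insert.prems(3)[OF _ upd[OF x \<open>c\<^sub>0 \<in> D\<close>] that]) (use j in blast)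
      then show ?thesis unfolding g'_def twist by presburger
    qed
  next
    fix x assume x: "x \<in> PiE T (\<lambda>_. D)"
    have "g' x = (\<lambda>m. g (x(l := c\<^sub>0)) (Suc m) - g (x(l := c\<^sub>0)) m)"
      by (simp add: g'_def fun_eq_iff)
    then show "degree_less (card A) (g' x)"
      using insert.prems(4)[OF upd[OF x \<open>c\<^sub>0 \<in> D\<close>]]
      by (simp only: card_insert_disjoint[OF insert.hyps] degree_less.simps)
  qed
  then show ?case
    unfolding S(1) sum_PiE_insert[OF S(2)] using inner by simp
qed

section \<open>Weighted orthogonal projection onto a finite family\<close>

text \<open>Gram-Schmidt for the semi-inner product with weights \<open>w\<close>: the new vector
  \<open>u i\<close> is first reduced to its own residual \<open>r\<close> against \<open>V\<close>,
  and a multiple of \<open>r\<close> is then subtracted from the residual of \<open>f\<close>. The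
  induction hypothesis serves both residuals, hence the arbitrary \<open>f\<close>.\<close>

lemma ex_orthogonal_residual:
  fixes w :: "'x \<Rightarrow> real" and u :: "'i \<Rightarrow> 'x \<Rightarrow> real"
  assumes "finite V" "finite \<Omega>" "\<And>x. x \<in> \<Omega> \<Longrightarrow> w x \<ge> 0"
  shows "\<exists>c. \<forall>v\<in>V. (\<Sum>x\<in>\<Omega>. w x * (f x - (\<Sum>i\<in>V. c i * u i x)) * u v x) = 0"
  using assms(1)
proof (induction V arbitrary: f rule: finite_induct)
  case (insert i V)
  define ip where "ip p q = (\<Sum>x\<in>\<Omega>. w x * p x * q x)" for p q :: "'x \<Rightarrow> real"
  have ip_lin: "ip p (\<lambda>x. q x + (\<Sum>j\<in>V. e j * u j x)) = ip p q + (\<Sum>j\<in>V. e j * ip p (u j))" for p q e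
  proof -
    have "ip p (\<lambda>x. q x + (\<Sum>j\<in>V. e j * u j x)) =
        ip p q + (\<Sum>x\<in>\<Omega>. \<Sum>j\<in>V. e j * (w x * p x * u j x))"
      by (simp add: ip_def distrib_left sum.distrib sum_distrib_left mult_ac)
    also have "(\<Sum>x\<in>\<Omega>. \<Sum>j\<in>V. e j * (w x * p x * u j x)) = (\<Sum>j\<in>V. e j * ip p (u j))"
      unfolding ip_def sum_distrib_left by (rule sum.swap)
    finally show ?thesis .
  qed
  obtain c where c: "\<And>v. v \<in> V \<Longrightarrow> ip (\<lambda>x. f x - (\<Sum>j\<in>V. c j * u j x)) (u v) = 0"
    using insert.IH[of f] by (auto simp: ip_def)
  obtain e where e: "\<And>v. v \<in> V \<Longrightarrow> ip (\<lambda>x. u i x - (\<Sum>j\<in>V. e j * u j x)) (u v) = 0"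
    using insert.IH[of "u i"] by (auto simp: ip_def)
  define g where "g = (\<lambda>x. f x - (\<Sum>j\<in>V. c j * u j x))"
  define r where "r = (\<lambda>x. u i x - (\<Sum>j\<in>V. e j * u j x))"
  have ui: "u i = (\<lambda>x. r x + (\<Sum>j\<in>V. e j * u j x))" by (simp add: r_def)
  \<comment> \<open>If \<open>r\<close> is null this is \<open>0\<close>, by \<open>x / 0 = 0\<close>.\<close>
  define t where "t = ip g r / ip r r"
  define h where "h = (\<lambda>x. g x - t * r x)"
  have ip_h: "ip h p = ip g p - t * ip r p" for p
    by (simp add: ip_def h_def sum_subtractf sum_distrib_left algebra_simps)
  have hV: "ip h (u v) = 0" if "v \<in> V" for v
    using c[OF that] e[OF that] by (simp add: ip_h g_def r_def)
  have "ip h r = 0"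
  proof (cases "ip r r = 0")
    case True
    \<comment> \<open>Nonnegative terms with sum 0 vanish, so \<open>w x * r x\<close> is zero at
      every point and a null \<open>r\<close> is orthogonal to everything.\<close>
    have "w x * r x * r x = 0" if "x \<in> \<Omega>" for x
      using True assms(2,3) that unfolding ip_def
      by (subst (asm) sum_nonneg_eq_0_iff) (auto simp: mult.assoc)
    then have "w x * r x = 0" if "x \<in> \<Omega>" for x using that by fastforce
    then have "ip h r = 0" unfolding ip_def by (intro sum.neutral) auto
    then show ?thesis .
  next
    case False
    then show ?thesis by (simp add: ip_h t_def)
  qed
  then have "ip h (u i) = 0"
    using ip_lin[of h r e] hV by (simp add: ui)
  then have all: "\<forall>v\<in>insert i V. ip h (u v) = 0" using hV by blast
  define k where "k j = (if j = i then t else c j - t * e j)" for j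
  have "h x = f x - (\<Sum>j\<in>insert i V. k j * u j x)" for x
  proof -
    have "(\<Sum>j\<in>V. k j * u j x) = (\<Sum>j\<in>V. c j * u j x) - t * (\<Sum>j\<in>V. e j * u j x)"
      unfolding sum_distrib_left sum_subtractf[symmetric] using insert.hyps
      by (intro sum.cong) (auto simp: k_def algebra_simps)
    then have "(\<Sum>j\<in>insert i V. k j * u j x) = t * u i x + (\<Sum>j\<in>V. c j * u j x) - t * (\<Sum>j\<in>V. e j * u j x)"
      using insert.hyps by (simp add: k_def)
    then show ?thesis by (simp add: h_def g_def r_def algebra_simps)
  qed
  then show ?case using all unfolding ip_def by auto
qed simp


section \<open>U-statistics on finite index sets\<close>

text \<open>A symmetric kernel on words is a function of multisets. Taking kernels on multisets
  makes symmetry automatic.\<close>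

abbreviation values_on :: "('i \<Rightarrow> 'd) \<Rightarrow> 'i set \<Rightarrow> 'd multiset" where
  "values_on x J \<equiv> image_mset x (mset_set J)"

lemma values_on_fun_upd: "l \<notin> J \<Longrightarrow> values_on (x(l := c)) J = values_on x J"
  by (cases "finite J") (auto intro!: image_mset_cong)

lemma values_on_insert: "finite J \<Longrightarrow> l \<notin> J \<Longrightarrow> values_on x (insert l J) = add_mset (x l) (values_on x J)"
  by simp

lemma values_on_fun_upd_in:
  "finite J \<Longrightarrow> l \<in> J \<Longrightarrow> values_on (x(l := c)) J = add_mset c (values_on x (J - {l}))"
  using values_on_insert[of "J - {l}" l "x(l := c)"] values_on_fun_upd[of l "J - {l}" x c]
  by (simp add: insert_absorb)

lemma values_on_Un:
  "finite I \<Longrightarrow> finite J \<Longrightarrow> I \<inter> J = {} \<Longrightarrow> values_on x (I \<union> J) = values_on x I + values_on x J"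
  by (simp add: mset_set_Union)

lemma values_on_subset: "x \<in> PiE S (\<lambda>_. D) \<Longrightarrow> J \<subseteq> S \<Longrightarrow> set_mset (values_on x J) \<subseteq> D"
  by (cases "finite J") (auto simp: PiE_iff)

lemma count_values_on: "finite J \<Longrightarrow> count (values_on x J) c = card {i\<in>J. x i = c}"
  by (simp add: count_image_mset_eq_card_vimage)

lemma ex_values_on:
  assumes "finite J" "card J = size N" "set_mset N \<subseteq> D"
  shows "\<exists>x\<in>PiE J (\<lambda>_. D). values_on x J = N"
  using assms
proof (induction J arbitrary: N rule: finite_induct)
  case empty
  then show ?case by auto
next
  case (insert l J)
  then obtain c N' where N: "N = add_mset c N'"
    by (cases N) auto
  obtain x where x: "x \<in> PiE J (\<lambda>_. D)" "values_on x J = N'"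
    using insert.IH[of N'] insert.prems insert.hyps N by auto
  have "x(l := c) \<in> PiE (insert l J) (\<lambda>_. D)"
    using x(1) insert.prems N by (auto simp: PiE_iff extensional_def)
  moreover have "values_on (x(l := c)) (insert l J) = N"
    using values_on_fun_upd[OF insert.hyps(2), of x c] insert.hyps x(2) N by simp
  ultimately show ?case by blast
qed

definition ustat :: "'i set \<Rightarrow> nat \<Rightarrow> ('d multiset \<Rightarrow> real) \<Rightarrow> ('i \<Rightarrow> 'd) \<Rightarrow> real" where
  "ustat S r f x = (\<Sum>J | J \<subseteq> S \<and> card J = r. f (values_on x J))"

text \<open>
  For a multiset \<open>N\<close> whose elements other than \<open>c\<^sub>0\<close> are as few as possible among the \<open>N\<close> with
  \<open>f N \<noteq> 0\<close>, evaluate at a point with values \<open>N\<close> padded by copies of \<open>c\<^sub>0\<close>: every index set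
  contributes \<open>f N\<close> or \<open>0\<close>.
\<close>

lemma ustat_injective:
  assumes "finite S" "r \<le> card S" "c\<^sub>0 \<in> D"
    and "\<And>x. x \<in> PiE S (\<lambda>_. D) \<Longrightarrow> ustat S r f x = 0"
    and "size N = r" "set_mset N \<subseteq> D"
  shows "f N = 0"
  using assms(5,6)
proof (induction "size (filter_mset (\<lambda>c. c \<noteq> c\<^sub>0) N)" arbitrary: N rule: less_induct)
  case less
  let ?F = "filter_mset (\<lambda>c. c \<noteq> c\<^sub>0)"
  define N' where "N' = N + replicate_mset (card S - r) c\<^sub>0"
  have "\<exists>x\<in>PiE S (\<lambda>_. D). values_on x S = N'"
    using assms less.prems by (intro ex_values_on) (auto simp: N'_def split: if_splits)
  then obtain x where x: "x \<in> PiE S (\<lambda>_. D)" "values_on x S = N'" by blast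
  have FN': "?F N' = ?F N" by (auto simp: N'_def filter_mset_eq_conv)
  define \<J> where "\<J> = {J. J \<subseteq> S \<and> card J = r}"
  have fin: "finite \<J>" using \<open>finite S\<close> by (simp add: \<J>_def)
  have val: "f (values_on x J) = (if values_on x J = N then f N else 0)" if "J \<in> \<J>" for J
  proof -
    have J: "J \<subseteq> S" "card J = r" "finite J"
      using that \<open>finite S\<close> finite_subset by (auto simp: \<J>_def)
    have sub: "values_on x J \<subseteq># N'"
      using x(2) J(1) \<open>finite S\<close> by (metis image_mset_subseteq_mono subset_imp_msubset_mset_set)
    then have Fsub: "?F (values_on x J) \<subseteq># ?F N"
      using FN' by (metis multiset_filter_mono)
    show ?thesis
    proof (cases "values_on x J = N")
      case False
      \<comment> \<open>Both multisets have size \<open>r\<close>, so agreeing away from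
        \<open>c\<^sub>0\<close> would force agreement at \<open>c\<^sub>0\<close> too. The
        inclusion \<open>Fsub\<close> is therefore strict and the induction hypothesis kills the
        term.\<close>
      have "?F (values_on x J) \<noteq> ?F N"
      proof
        assume eq: "?F (values_on x J) = ?F N"
        have part: "M = ?F M + replicate_mset (count M c\<^sub>0) c\<^sub>0" for M :: "'b multiset"
          by (rule multiset_eqI) auto
        have "size (values_on x J) = size N" using J less.prems by simp
        have "count (values_on x J) c\<^sub>0 = count N c\<^sub>0"
        proof -
          have "size (values_on x J) = size (?F (values_on x J)) + count (values_on x J) c\<^sub>0"
            by (subst part) simp
          moreover have "size N = size (?F N) + count N c\<^sub>0" by (subst part) simp
          ultimately show ?thesis using \<open>size (values_on x J) = size N\<close> eq by simp
        qed
        then show False using False eq part[of N] part[of "values_on x J"] by (metis (no_types))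
      qed
      then have "size (?F (values_on x J)) < size (?F N)"
        using Fsub by (metis mset_subset_size subset_mset.less_le)
      then have "f (values_on x J) = 0"
        using less.hyps J values_on_subset[OF x(1) J(1)] by simp
      then show ?thesis using False by simp
    qed simp
  qed
  obtain J\<^sub>1 where J1: "J\<^sub>1 \<in> \<J>" "values_on x J\<^sub>1 = N"
  proof -
    \<comment> \<open>Some submultiset of \<open>mset_set S\<close> is mapped onto \<open>N\<close>;
      its multiplicities are at most 1, which makes it an index set.\<close>
    obtain J' R where J': "mset_set S = J' + R" "N = image_mset x J'"
      using image_mset_eq_plusD[of x "mset_set S" N "replicate_mset (card S - r) c\<^sub>0"] x(2)
      by (auto simp: N'_def)
    have "count J' i \<le> count (mset_set S) i" for i using J'(1) by simp
    then have "count J' i \<le> 1" for i by (metis count_mset_set(1,2,3) le_trans order_refl zero_le_one)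
    then have "J' = mset_set (set_mset J')"
      by (simp add: multiset_eq_iff count_mset_set' not_in_iff[symmetric] le_antisym Suc_le_eq)
    moreover have "set_mset J' \<subseteq> S"
      using J'(1) \<open>finite S\<close> by (metis finite_set_mset_mset_set inf_sup_ord(3) set_mset_union)
    moreover have "card (set_mset J') = r"
      using calculation(1) J'(2) less.prems(1) by (metis size_image_mset size_mset_set)
    ultimately show ?thesis
      using that[of "set_mset J'"] J'(2) by (auto simp: \<J>_def)
  qed
  have "0 = (\<Sum>J\<in>\<J>. f (values_on x J))"
    using assms(4)[OF x(1)] by (simp add: ustat_def \<J>_def)
  also have "\<dots> = (\<Sum>J\<in>\<J>. if values_on x J = N then f N else 0)"
    using val by (intro sum.cong) auto
  also have "\<dots> = real (card {J\<in>\<J>. values_on x J = N}) * f N"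
    using fin by (simp add: sum.If_cases Int_def)
  finally have "real (card {J\<in>\<J>. values_on x J = N}) * f N = 0" by simp
  moreover have "card {J\<in>\<J>. values_on x J = N} > 0"
    using J1 fin by (subst card_gt_0_iff) auto
  ultimately show ?case by simp
qed

section \<open>Raising the order of a kernel\<close>

text \<open>Realises the inclusion of U-statistics of order \<open>r\<close> among those of order
  \<open>r + 1\<close>: the statistic of the lift is a multiple of the statistic of
  \<open>h\<close>, by a factor that is positive while \<open>r < card S\<close>.\<close>

definition lift_kernel :: "('d multiset \<Rightarrow> real) \<Rightarrow> 'd multiset \<Rightarrow> real" where
  "lift_kernel h N = (\<Sum>c\<in>#N. h (N - {#c#}))"

lemma lift_kernel_values_on:
  assumes "finite J"
  shows "lift_kernel h (values_on x J) = (\<Sum>l\<in>J. h (values_on x (J - {l})))"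
proof -
  have "lift_kernel h (values_on x J) = (\<Sum>l\<in>J. h (values_on x J - {#x l#}))"
    by (simp add: lift_kernel_def sum_unfold_sum_mset image_mset.compositionality comp_def)
  also have "\<dots> = (\<Sum>l\<in>J. h (values_on x (J - {l})))"
  proof (intro sum.cong refl arg_cong[where f = h])
    fix l assume "l \<in> J"
    then have "values_on x J = add_mset (x l) (values_on x (J - {l}))"
      using values_on_fun_upd_in[OF assms, of l x "x l"] by (simp only: fun_upd_triv)
    then show "values_on x J - {#x l#} = values_on x (J - {l})" by simp
  qed
  finally show ?thesis .
qed

text \<open>Double counting: removing a marked element from an index set of size
  \<open>r + 1\<close> leaves a set of size \<open>r\<close> with a marked element outside it, which
  can be chosen in \<open>card S - r\<close> ways.\<close>

lemma ustat_lift_kernel: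
  assumes "finite S"
  shows "ustat S (Suc r) (lift_kernel h) x = real (card S - r) * ustat S r h x"
proof -
  define \<J> where "\<J> m = {J. J \<subseteq> S \<and> card J = m}" for m
  have fin: "finite (\<J> m)" for m using assms by (simp add: \<J>_def)
  have finJ: "finite J" if "J \<in> \<J> m" for J m
    using that assms finite_subset by (auto simp: \<J>_def)
  have "ustat S (Suc r) (lift_kernel h) x = (\<Sum>J\<in>\<J> (Suc r). \<Sum>l\<in>J. h (values_on x (J - {l})))"
    unfolding ustat_def \<J>_def[symmetric]
    using finJ by (intro sum.cong) (auto simp: lift_kernel_values_on)
  also have "\<dots> = (\<Sum>(J, l)\<in>Sigma (\<J> (Suc r)) (\<lambda>J. J). h (values_on x (J - {l})))"
    using fin finJ by (intro sum.Sigma) auto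
  also have "\<dots> = (\<Sum>(I, l)\<in>Sigma (\<J> r) (\<lambda>I. S - I). h (values_on x I))"
  proof (rule sum.reindex_bij_witness
      [where i = "\<lambda>(I, l). (insert l I, l)" and j = "\<lambda>(J, l). (J - {l}, l)"], goal_cases)
    case (2 p)
    then obtain J l where p: "p = (J, l)" "J \<in> \<J> (Suc r)" "l \<in> J" by auto
    then show ?case using finJ[OF p(2)] by (auto simp: \<J>_def)
  next
    case (4 p)
    then obtain I l where p: "p = (I, l)" "I \<in> \<J> r" "l \<in> S" "l \<notin> I" by auto
    then show ?case using finJ[OF p(2)] by (auto simp: \<J>_def)
  qed (clarsimp simp: insert_absorb)+
  also have "\<dots> = (\<Sum>I\<in>\<J> r. \<Sum>l\<in>S - I. h (values_on x I))"
    using fin assms by (intro sum.Sigma[symmetric]) auto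
  also have "\<dots> = (\<Sum>I\<in>\<J> r. real (card S - r) * h (values_on x I))"
    using finJ by (intro sum.cong) (auto simp: \<J>_def card_Diff_subset)
  also have "\<dots> = real (card S - r) * ustat S r h x"
    by (simp add: ustat_def \<J>_def sum_distrib_left)
  finally show ?thesis .
qed

lemma ustat_full: "finite S \<Longrightarrow> ustat S (card S) f x = f (values_on x S)"
proof -
  assume "finite S"
  then have "{J. J \<subseteq> S \<and> card J = card S} = {S}" by (auto dest: card_subset_eq)
  then show ?thesis by (simp add: ustat_def)
qed

lemma ustat_zero: "finite S \<Longrightarrow> ustat S 0 f x = f {#}"
proof -
  assume "finite S"
  then have "{J. J \<subseteq> S \<and> card J = 0} = {{}}" by (auto dest: finite_subset)
  then show ?thesis by (simp add: ustat_def)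
qed

text \<open>Used to place U-statistics in \<open>L_s\<close>. Lifting raises the order step by step
  to \<open>card S\<close>, where \<open>S\<close> is the only index set; the factor divided out is
  nonzero because \<open>k < card S\<close> at each step.\<close>

lemma ustat_eq_multiset_fun:
  assumes "finite S" "k \<le> card S"
  shows "\<exists>g. \<forall>x. ustat S k f x = g (values_on x S)"
  using assms(2)
proof (induction k arbitrary: f rule: inc_induct)
  case base
  then show ?case using ustat_full[OF assms(1)] by blast
next
  case (step k)
  obtain g where "\<And>x. ustat S (Suc k) (lift_kernel f) x = g (values_on x S)"
    using step.IH by blast
  then have "ustat S k f x = g (values_on x S) / real (card S - k)" for x
    using step.hyps ustat_lift_kernel[OF assms(1), of k f x] by (simp add: field_simps)
  then show ?case by (intro exI[of _ "\<lambda>N. g N / real (card S - k)"]) simp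
qed


section \<open>Degenerate kernels of the urn\<close>

text \<open>The urn alone decides on \<open>c\<^sub>0\<close>, which therefore carries weight 1. On
  the other colours \<open>B\<close> is the probability distribution that refines the outcome "not
  \<open>c\<^sub>0\<close>".\<close>

locale two_stage_urn =
  fixes D :: "'d set" and c\<^sub>0 :: 'd and B :: "'d \<Rightarrow> real" and \<pi> \<nu> :: real
  assumes finite_D: "finite D" and c0_in_D: "c\<^sub>0 \<in> D"
    and B_pos: "c \<in> D \<Longrightarrow> B c > 0" and B_c0: "B c\<^sub>0 = 1" and sum_B: "(\<Sum>c\<in>D - {c\<^sub>0}. B c) = 1"
    and pi_pos: "\<pi> > 0" and nu_pos: "\<nu> > 0"
begin

section \<open>Word probabilities and their consistency\<close>

text \<open>The probability of one word with colours \<open>N\<close>, not of the multiset; hence no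
  multinomial coefficient appears.\<close>

definition weight :: "'d multiset \<Rightarrow> real" where
  "weight N = (\<Prod>c\<in>#N. B c) * pochhammer \<pi> (count N c\<^sub>0) * pochhammer \<nu> (size N - count N c\<^sub>0)
    / pochhammer (\<pi> + \<nu>) (size N)"

text \<open>The conditional probability of a further word with colours \<open>Y\<close> after
  \<open>n\<close> draws, \<open>m\<close> of which gave \<open>c\<^sub>0\<close>. With
  \<open>m\<close> real the formula is a polynomial in \<open>m\<close>; a natural
  \<open>n - m\<close> would truncate.\<close>

definition conditional_weight :: "nat \<Rightarrow> real \<Rightarrow> 'd multiset \<Rightarrow> real" where
  "conditional_weight n m Y = (\<Prod>c\<in>#Y. B c) * pochhammer (\<pi> + m) (count Y c\<^sub>0)
    * pochhammer (\<nu> + real n - m) (size Y - count Y c\<^sub>0) / pochhammer (\<pi> + \<nu> + real n) (size Y)"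

lemma weight_union:
  "weight (N + Y) = weight N * conditional_weight (size N) (real (count N c\<^sub>0)) Y"
proof -
  have le: "count N c\<^sub>0 \<le> size N" "count Y c\<^sub>0 \<le> size Y" by (simp_all add: count_le_size)
  then have eq: "size (N + Y) - count (N + Y) c\<^sub>0 = (size N - count N c\<^sub>0) + (size Y - count Y c\<^sub>0)" by simp
  have "pochhammer \<nu> (size (N + Y) - count (N + Y) c\<^sub>0) = pochhammer \<nu> (size N - count N c\<^sub>0)
      * pochhammer (\<nu> + real (size N) - real (count N c\<^sub>0)) (size Y - count Y c\<^sub>0)"
    unfolding eq pochhammer_product' using le by (simp add: of_nat_diff add_diff_eq)
  then show ?thesis
    by (simp only: weight_def conditional_weight_def) (simp add: pochhammer_product' add.assoc)
qed

lemma weight_pos: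
  assumes "set_mset N \<subseteq> D"
  shows "weight N > 0"
proof -
  have "(\<Prod>c\<in>#N. B c) > 0"
    using assms by (induction N) (auto simp: B_pos)
  then show ?thesis
    unfolding weight_def using pi_pos nu_pos
    by (intro divide_pos_pos mult_pos_pos pochhammer_pos) auto
qed

text \<open>After \<open>?n\<close> draws with \<open>?m\<close> times \<open>c\<^sub>0\<close>, the
  next draw is \<open>c\<^sub>0\<close> with probability
  \<open>(\<pi> + ?m) / (\<pi> + \<nu> + ?n)\<close>; the other colours share the complement in the
  proportions \<open>B\<close>.\<close>

lemma sum_weight_add_mset: "(\<Sum>c\<in>D. weight (add_mset c N)) = weight N"
proof -
  let ?n = "real (size N)" and ?m = "real (count N c\<^sub>0)"
  have cw: "weight (add_mset c N) = weight N * conditional_weight (size N) ?m {#c#}" for c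
    using weight_union[of N "{#c#}"] by simp
  have "(\<Sum>c\<in>D. conditional_weight (size N) ?m {#c#}) =
      (\<pi> + ?m) / (\<pi> + \<nu> + ?n) + (\<Sum>c\<in>D - {c\<^sub>0}. conditional_weight (size N) ?m {#c#})"
    using finite_D c0_in_D by (subst sum.remove) (auto simp: conditional_weight_def B_c0)
  also have "(\<Sum>c\<in>D - {c\<^sub>0}. conditional_weight (size N) ?m {#c#}) =
      (\<Sum>c\<in>D - {c\<^sub>0}. B c * ((\<nu> + ?n - ?m) / (\<pi> + \<nu> + ?n)))"
    by (intro sum.cong) (auto simp: conditional_weight_def)
  also have "\<dots> = (\<nu> + ?n - ?m) / (\<pi> + \<nu> + ?n)"
    by (simp only: sum_distrib_right[symmetric] sum_B mult_1)
  finally have "(\<Sum>c\<in>D. conditional_weight (size N) ?m {#c#}) = 1"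
    using pi_pos nu_pos by (simp add: add_divide_distrib[symmetric])
  then show ?thesis by (simp add: cw sum_distrib_left[symmetric])
qed

text \<open>Kolmogorov consistency: the coordinates that \<open>h\<close> ignores are summed out one
  at a time.\<close>

lemma sum_weight_marginal:
  fixes h :: "('i \<Rightarrow> 'd) \<Rightarrow> real"
  assumes "finite S" "finite T" "S \<inter> T = {}"
    and "\<And>x l c. l \<in> S \<Longrightarrow> h (x(l := c)) = h x"
  shows "(\<Sum>x\<in>PiE (S \<union> T) (\<lambda>_. D). weight (values_on x (S \<union> T)) * h x) =
    (\<Sum>x\<in>PiE T (\<lambda>_. D). weight (values_on x T) * h x)"
  using assms(1,3,4)
proof (induction S rule: finite_induct)
  case (insert l S)
  have l: "l \<notin> S \<union> T" using insert by auto
  have "(\<Sum>x\<in>PiE (insert l S \<union> T) (\<lambda>_. D). weight (values_on x (insert l S \<union> T)) * h x) =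
      (\<Sum>x\<in>PiE (S \<union> T) (\<lambda>_. D). \<Sum>c\<in>D. weight (add_mset c (values_on x (S \<union> T))) * h x)"
    unfolding Un_insert_left sum_PiE_insert[OF l]
    using insert.hyps(1) assms(2) l insert.prems(2)
    by (intro sum.cong refl) (simp add: values_on_insert values_on_fun_upd[OF l] fun_upd_same del: fun_upd_apply)
  also have "\<dots> = (\<Sum>x\<in>PiE (S \<union> T) (\<lambda>_. D). weight (values_on x (S \<union> T)) * h x)"
    by (simp only: sum_distrib_right[symmetric] sum_weight_add_mset)
  also have "\<dots> = (\<Sum>x\<in>PiE T (\<lambda>_. D). weight (values_on x T) * h x)"
    using insert.prems by (intro insert.IH) auto
  finally show ?case .
qed simp

section \<open>Degenerate kernels and orthogonality\<close>

text \<open>Here \<open>r\<close> counts the conditioning coordinates, so the kernel has order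
  \<open>r + 1\<close>. The sum is the conditional expectation given \<open>N\<close>, multiplied by
  the positive number \<open>weight N\<close>.\<close>

definition degenerate :: "nat \<Rightarrow> ('d multiset \<Rightarrow> real) \<Rightarrow> bool" where
  "degenerate r f \<longleftrightarrow> (\<forall>N. size N = r \<longrightarrow> set_mset N \<subseteq> D \<longrightarrow>
    (\<Sum>c\<in>D. weight (add_mset c N) * f (add_mset c N)) = 0)"

text \<open>
  Given \<open>(x\<^sub>j)\<^sub>j\<^sub>\<in>\<^sub>J\<close>, the law of the \<open>s = |I - J|\<close> remaining coordinates is a polynomial of degree at most
  \<open>s\<close> in the number of \<open>c\<^sub>0\<close> among the \<open>s + 1\<close> coordinates in \<open>J - I\<close>.
\<close>

lemma degenerate_orthogonal:
  assumes "finite J" "finite I" "card J = Suc r" "card I = r" "degenerate r f"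
  shows "(\<Sum>x\<in>PiE (J \<union> I) (\<lambda>_. D). weight (values_on x (J \<union> I)) * (f (values_on x J) * h (values_on x I))) = 0"
proof -
  define A C Y where "A = J - I" and "C = J \<inter> I" and "Y = I - J"
  have fin: "finite A" "finite C" "finite Y" using assms by (auto simp: A_def C_def Y_def)
  have J: "J = C \<union> A" "C \<inter> A = {}" and JI: "J \<union> I = J \<union> Y" "J \<inter> Y = {}"
    by (auto simp: A_def C_def Y_def)
  have "card J = card A + card C" "card I = card Y + card C"
    unfolding A_def C_def Y_def
    using card_Int_Diff[OF assms(1), of I] card_Int_Diff[OF assms(2), of J] by (simp_all add: Int_commute)
  then have cA: "card A = Suc (card Y)" using assms by simp
  define Q where "Q x = weight (values_on x J) * f (values_on x J)" for x
  \<comment> \<open>Only the \<open>c\<^sub>0\<close> in \<open>A\<close> form the polynomial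
    variable. Those in \<open>C\<close> are shared with \<open>I\<close> and enter as a constant, so
    \<open>g\<close> ignores the coordinates in \<open>A\<close>.\<close>
  define g where "g x m = conditional_weight (Suc r) (real (count (values_on x C) c\<^sub>0) + real m) (values_on x Y)
      * h (values_on x I)" for x m
  have "weight (values_on x (J \<union> I)) * (f (values_on x J) * h (values_on x I)) =
      Q x * g x (card {i\<in>A. x i = c\<^sub>0})" for x
  proof -
    have "values_on x (J \<union> I) = values_on x J + values_on x Y"
      unfolding JI(1) using assms(1) fin JI(2) by (intro values_on_Un)
    moreover have "real (count (values_on x J) c\<^sub>0) =
        real (count (values_on x C) c\<^sub>0) + real (card {i\<in>A. x i = c\<^sub>0})"
      unfolding J(1) values_on_Un[OF fin(2,1) J(2)] using fin by (simp add: count_values_on)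
    moreover have "size (values_on x J) = Suc r" using assms by simp
    ultimately show ?thesis by (simp add: weight_union Q_def g_def)
  qed
  moreover have "(\<Sum>x\<in>PiE (J \<union> I) (\<lambda>_. D). Q x * g x (card {i\<in>A. x i = c\<^sub>0})) = 0"
  proof (rule sum_zero_marginals_polynomial[OF fin(1) finite_D c0_in_D])
    show "A \<subseteq> J \<union> I" by (auto simp: A_def)
  next
    fix l x assume l: "l \<in> A" and x: "x \<in> PiE (J \<union> I) (\<lambda>_. D)"
    have lJ: "l \<in> J" and ln: "l \<notin> C" "l \<notin> Y" "l \<notin> I" using l by (auto simp: A_def C_def Y_def)
    have "size (values_on x (J - {l})) = r" "set_mset (values_on x (J - {l})) \<subseteq> D"
      using assms lJ values_on_subset[OF x, of "J - {l}"] by auto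
    then show "(\<Sum>c\<in>D. Q (x(l := c))) = 0"
      using assms(5) unfolding Q_def values_on_fun_upd_in[OF assms(1) lJ] degenerate_def by blast
    show "g (x(l := c)) = g x" for c
      unfolding g_def ln[THEN values_on_fun_upd] ..
  next
    fix x assume x: "x \<in> PiE (J \<union> I) (\<lambda>_. D)"
    let ?Z = "values_on x Y" and ?k = "real (count (values_on x C) c\<^sub>0)"
    \<comment> \<open>A constant has degree below 1, and the two Pochhammer symbols, of slopes 1 and
      -1, add \<open>size ?Z = card Y\<close>. The bound \<open>1 + card Y\<close> is exactly
      \<open>card A\<close>.\<close>
    have "degree_less 1 (\<lambda>_. (\<Prod>c\<in>#?Z. B c) / pochhammer (\<pi> + \<nu> + real (Suc r)) (size ?Z) * h (values_on x I))"
      (is "degree_less 1 (\<lambda>_. ?c)") by simp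
    then have "degree_less (1 + count ?Z c\<^sub>0 + (size ?Z - count ?Z c\<^sub>0))
        (\<lambda>m. ?c * pochhammer ((\<pi> + ?k) + 1 * real m) (count ?Z c\<^sub>0)
          * pochhammer ((\<nu> + real (Suc r) - ?k) + (-1) * real m) (size ?Z - count ?Z c\<^sub>0))"
      by (intro degree_less_mult_pochhammer)
    moreover have "1 + count ?Z c\<^sub>0 + (size ?Z - count ?Z c\<^sub>0) = card A"
      using count_le_size[of ?Z c\<^sub>0] cA by simp
    moreover have "(\<lambda>m. ?c * pochhammer ((\<pi> + ?k) + 1 * real m) (count ?Z c\<^sub>0)
          * pochhammer ((\<nu> + real (Suc r) - ?k) + (-1) * real m) (size ?Z - count ?Z c\<^sub>0)) = g x"
      by (rule ext) (simp add: g_def conditional_weight_def algebra_simps)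
    ultimately show "degree_less (card A) (g x)" by (simp only:)
  qed
  ultimately show ?thesis by simp
qed

definition urn_ip :: "'i set \<Rightarrow> (('i \<Rightarrow> 'd) \<Rightarrow> real) \<Rightarrow> (('i \<Rightarrow> 'd) \<Rightarrow> real) \<Rightarrow> real" where
  "urn_ip S F G = (\<Sum>x\<in>PiE S (\<lambda>_. D). weight (values_on x S) * (F x * G x))"

lemma degenerate_imp_ustat_orthogonal:
  assumes "finite S" "degenerate r f"
  shows "urn_ip S (ustat S (Suc r) f) (ustat S r h) = 0"
proof -
  let ?\<J> = "\<lambda>m. {J. J \<subseteq> S \<and> card J = m}"
  have fin: "finite (?\<J> m)" for m using assms(1) by simp
  have "urn_ip S (ustat S (Suc r) f) (ustat S r h) = (\<Sum>x\<in>PiE S (\<lambda>_. D). \<Sum>J\<in>?\<J> (Suc r). \<Sum>I\<in>?\<J> r.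
      weight (values_on x S) * (f (values_on x J) * h (values_on x I)))"
    unfolding urn_ip_def ustat_def sum_product by (simp only: sum_distrib_left)
  also have "\<dots> = (\<Sum>J\<in>?\<J> (Suc r). \<Sum>x\<in>PiE S (\<lambda>_. D). \<Sum>I\<in>?\<J> r.
      weight (values_on x S) * (f (values_on x J) * h (values_on x I)))"
    by (rule sum.swap)
  also have "\<dots> = (\<Sum>J\<in>?\<J> (Suc r). \<Sum>I\<in>?\<J> r. \<Sum>x\<in>PiE S (\<lambda>_. D).
      weight (values_on x S) * (f (values_on x J) * h (values_on x I)))"
    by (intro sum.cong refl sum.swap)
  also have "\<dots> = 0"
  proof (rule sum.neutral, rule ballI, rule sum.neutral, rule ballI)
    fix J I assume J: "J \<in> ?\<J> (Suc r)" and I: "I \<in> ?\<J> r"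
    have fJI: "finite J" "finite I" using J I assms(1) finite_subset by auto
    have S: "S = (S - (J \<union> I)) \<union> (J \<union> I)" using J I by auto
    \<comment> \<open>The orthogonality of two single terms is known on \<open>J \<union> I\<close>,
      so the remaining coordinates of \<open>S\<close> are summed out first.\<close>
    have "(\<Sum>x\<in>PiE S (\<lambda>_. D). weight (values_on x S) * (f (values_on x J) * h (values_on x I))) =
        (\<Sum>x\<in>PiE (J \<union> I) (\<lambda>_. D). weight (values_on x (J \<union> I)) * (f (values_on x J) * h (values_on x I)))"
      by (subst (1 2) S, rule sum_weight_marginal)
         (use assms(1) fJI in \<open>auto simp: values_on_fun_upd simp del: fun_upd_apply\<close>)
    also have "\<dots> = 0"
      using J I fJI assms(2) by (intro degenerate_orthogonal[where r = r]) auto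
    finally show "(\<Sum>x\<in>PiE S (\<lambda>_. D). weight (values_on x S) * (f (values_on x J) * h (values_on x I))) = 0" .
  qed
  finally show ?thesis .
qed

text \<open>The kernel is projected onto the span of the lifted indicators of multisets of size
  \<open>r\<close>. Orthogonality of the residual to the lifted indicator of \<open>N\<close> says
  that its marginal at \<open>N\<close> vanishes.\<close>

lemma ex_degenerate_residual:
  "\<exists>h. degenerate r (\<lambda>N. f N - lift_kernel h N)"
proof -
  \<comment> \<open>This set has \<open>r + 1\<close> elements, one for each argument of the
    kernel.\<close>
  define S where "S = {..r}"
  define V where "V = {N. set_mset N \<subseteq> D \<and> size N = r}"
  define u where "u N x = lift_kernel (\<lambda>N'. if N' = N then 1 else 0) (values_on x S)"
    for N :: "'d multiset" and x :: "nat \<Rightarrow> 'd"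
  have finV: "finite V"
    using finite_multisets_of_size[OF finite_D, of r] by (simp add: V_def multisets_of_size_def)
  have finP: "finite (PiE S (\<lambda>_. D))" using finite_D by (simp add: S_def finite_PiE)
  have "weight (values_on x S) \<ge> 0" if "x \<in> PiE S (\<lambda>_. D)" for x
    using weight_pos[OF values_on_subset[OF that order_refl]] by simp
  from ex_orthogonal_residual[where w = "\<lambda>x. weight (values_on x S)", OF finV finP this, where f = "\<lambda>x. f (values_on x S)" and u = u]
  obtain a where a: "\<And>N. N \<in> V \<Longrightarrow>
      (\<Sum>x\<in>PiE S (\<lambda>_. D). weight (values_on x S) * (f (values_on x S) - (\<Sum>M\<in>V. a M * u M x)) * u N x) = 0"
    by blast
  define h where "h N = (if N \<in> V then a N else 0)" for N
  define f' where "f' N = f N - lift_kernel h N" for N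
  have "degenerate r f'"
    unfolding degenerate_def
  proof (intro allI impI)
    fix N assume N: "size N = r" "set_mset N \<subseteq> D"
    then have NV: "N \<in> V" by (simp add: V_def)
    define t where "t = (\<Sum>c\<in>D. weight (add_mset c N) * f' (add_mset c N))"
    define W where "W l = {x\<in>PiE (S - {l}) (\<lambda>_. D). values_on x (S - {l}) = N}" for l
    have hsum: "(\<Sum>M\<in>V. a M * u M x) = lift_kernel h (values_on x S)" for x
    proof -
      have "(\<Sum>M\<in>V. a M * u M x) =
          (\<Sum>M\<in>V. \<Sum>l\<in>S. if values_on x (S - {l}) = M then a M else 0)"
        by (auto simp: u_def lift_kernel_values_on S_def sum_distrib_left intro!: sum.cong)
      also have "\<dots> = (\<Sum>l\<in>S. h (values_on x (S - {l})))"
        using finV by (subst sum.swap) (simp add: h_def sum.delta)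
      finally show ?thesis by (simp add: lift_kernel_values_on S_def)
    qed
    have "0 = (\<Sum>x\<in>PiE S (\<lambda>_. D). weight (values_on x S) * f' (values_on x S) * u N x)"
      using a[OF NV] unfolding hsum f'_def by simp
    also have "\<dots> = (\<Sum>x\<in>PiE S (\<lambda>_. D). \<Sum>l\<in>S.
        if values_on x (S - {l}) = N then weight (values_on x S) * f' (values_on x S) else 0)"
      by (auto simp: u_def lift_kernel_values_on S_def sum_distrib_left intro!: sum.cong)
    also have "\<dots> = (\<Sum>l\<in>S. \<Sum>x\<in>PiE S (\<lambda>_. D).
        if values_on x (S - {l}) = N then weight (values_on x S) * f' (values_on x S) else 0)"
      by (rule sum.swap)
    \<comment> \<open>Each position \<open>l\<close> contributes the same marginal \<open>t\<close>,
      once for every arrangement of \<open>N\<close> on the other positions. The total number of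
      arrangements is positive and cancels.\<close>
    also have "\<dots> = (\<Sum>l\<in>S. real (card (W l)) * t)"
    proof (rule sum.cong[OF refl])
      fix l assume l: "l \<in> S"
      then have S: "S = insert l (S - {l})" "l \<notin> S - {l}" by auto
      have finS: "finite S" by (simp add: S_def)
      have "(\<Sum>x\<in>PiE S (\<lambda>_. D). if values_on x (S - {l}) = N then weight (values_on x S) * f' (values_on x S) else 0) =
          (\<Sum>x\<in>PiE (S - {l}) (\<lambda>_. D). \<Sum>c\<in>D. if values_on (x(l := c)) (S - {l}) = N
            then weight (values_on (x(l := c)) S) * f' (values_on (x(l := c)) S) else 0)"
        by (subst S(1), rule sum_PiE_insert[OF S(2)])
      also have "\<dots> = (\<Sum>x\<in>PiE (S - {l}) (\<lambda>_. D). if values_on x (S - {l}) = N then t else 0)"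
        unfolding values_on_fun_upd[OF S(2)] values_on_fun_upd_in[OF finS l]
        by (intro sum.cong refl) (simp add: t_def)
      also have "\<dots> = real (card (W l)) * t"
        using finite_D by (simp add: sum.If_cases W_def Int_def finite_PiE finS)
      finally show "(\<Sum>x\<in>PiE S (\<lambda>_. D). if values_on x (S - {l}) = N then weight (values_on x S) * f' (values_on x S) else 0)
          = real (card (W l)) * t" .
    qed
    also have "\<dots> = (\<Sum>l\<in>S. real (card (W l))) * t" by (simp add: sum_distrib_right)
    finally have "(\<Sum>l\<in>S. real (card (W l))) * t = 0" by simp
    moreover have "(\<Sum>l\<in>S. real (card (W l))) > 0"
    proof (rule sum_pos)
      fix l assume "l \<in> S"
      then have "card (S - {l}) = size N" using N by (simp add: S_def)
      then have "W l \<noteq> {}" using ex_values_on[of "S - {l}" N D] N by (auto simp: W_def S_def)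
      moreover have "finite (W l)"
        using finite_D unfolding W_def S_def
        by (intro finite_subset[OF _ finite_PiE[of "{..r} - {l}" "\<lambda>_. D"]]) auto
      ultimately show "real (card (W l)) > 0" by (simp add: card_gt_0_iff)
    qed (auto simp: S_def)
    ultimately show "(\<Sum>c\<in>D. weight (add_mset c N) * f' (add_mset c N)) = 0" by (simp add: t_def)
  qed
  then show ?thesis unfolding f'_def by blast
qed

lemma degenerate_iff_ustat_orthogonal:
  assumes "finite S" "Suc r \<le> card S"
  shows "degenerate r f \<longleftrightarrow> (\<forall>h. urn_ip S (ustat S (Suc r) f) (ustat S r h) = 0)"
proof
  assume "degenerate r f"
  then show "\<forall>h. urn_ip S (ustat S (Suc r) f) (ustat S r h) = 0"
    using degenerate_imp_ustat_orthogonal[OF assms(1)] by blast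
next
  assume orth: "\<forall>h. urn_ip S (ustat S (Suc r) f) (ustat S r h) = 0"
  obtain h where h: "degenerate r (\<lambda>N. f N - lift_kernel h N)"
    using ex_degenerate_residual by blast
  let ?G = "ustat S r h"
  have "ustat S (Suc r) f x = ustat S (Suc r) (\<lambda>N. f N - lift_kernel h N) x + real (card S - r) * ?G x" for x
    unfolding ustat_lift_kernel[OF assms(1), symmetric] by (simp add: ustat_def sum_subtractf)
  then have "urn_ip S (ustat S (Suc r) f) ?G =
      urn_ip S (ustat S (Suc r) (\<lambda>N. f N - lift_kernel h N)) ?G + real (card S - r) * urn_ip S ?G ?G"
    by (simp add: urn_ip_def sum.distrib sum_distrib_left algebra_simps)
  \<comment> \<open>Both the statistic of \<open>f\<close> and that of its degenerate part are
    orthogonal to \<open>?G\<close>, and \<open>card S - r\<close> is positive.\<close>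
  then have "urn_ip S ?G ?G = 0"
    using orth degenerate_imp_ustat_orthogonal[OF assms(1) h] assms(2) by simp
  \<comment> \<open>Strict positivity of \<open>weight\<close> turns the null norm into vanishing at
    every point, as the injectivity of U-statistics requires.\<close>
  have zero: "?G x = 0" if x: "x \<in> PiE S (\<lambda>_. D)" for x
  proof -
    have "finite (PiE S (\<lambda>_. D))" using finite_D assms(1) by (simp add: finite_PiE)
    moreover have "weight (values_on y S) * (?G y * ?G y) \<ge> 0" if "y \<in> PiE S (\<lambda>_. D)" for y
      using weight_pos[OF values_on_subset[OF that order_refl]] by simp
    ultimately have "weight (values_on x S) * (?G x * ?G x) = 0"
      using \<open>urn_ip S ?G ?G = 0\<close> x unfolding urn_ip_def by (subst (asm) sum_nonneg_eq_0_iff) blast+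
    then show ?thesis using weight_pos[OF values_on_subset[OF x order_refl]] by simp
  qed
  have h0: "h N = 0" if "size N = r" "set_mset N \<subseteq> D" for N
    by (rule ustat_injective[OF assms(1) _ c0_in_D zero that]) (use assms(2) in auto)
  show "degenerate r f"
    unfolding degenerate_def
  proof (intro allI impI)
    fix N assume N: "size N = r" "set_mset N \<subseteq> D"
    have "lift_kernel h (add_mset c N) = 0" if "c \<in> D" for c
    proof -
      have "h (add_mset c N - {#c'#}) = 0" if "c' \<in># add_mset c N" for c'
        using that N \<open>c \<in> D\<close> by (intro h0) (auto simp: size_Diff_singleton dest!: in_diffD split: if_splits)
      then have "image_mset (\<lambda>c'. h (add_mset c N - {#c'#})) (add_mset c N) =
          image_mset (\<lambda>_. 0) (add_mset c N)"
        by (intro image_mset_cong) auto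
      then show ?thesis by (simp only: lift_kernel_def) simp
    qed
    then have "(\<Sum>c\<in>D. weight (add_mset c N) * f (add_mset c N)) =
        (\<Sum>c\<in>D. weight (add_mset c N) * (f (add_mset c N) - lift_kernel h (add_mset c N)))"
      by (intro sum.cong) auto
    also have "\<dots> = 0" using h N by (simp add: degenerate_def)
    finally show "(\<Sum>c\<in>D. weight (add_mset c N) * f (add_mset c N)) = 0" .
  qed
qed

end


section \<open>Hoeffding decomposability of the urn process\<close>

lemma symmetric_fun_mset: "symmetric_fun D k (\<lambda>xs. h (mset xs))"
  by (auto simp: symmetric_fun_def tuples_def)

lemma symmetric_fun_imp_mset:
  assumes "symmetric_fun D k \<phi>"
  shows "\<exists>f. \<forall>xs\<in>tuples D k. \<phi> xs = f (mset xs)"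
proof (intro exI ballI)
  fix xs assume xs: "xs \<in> tuples D k"
  \<comment> \<open>The witness is \<open>f N = \<phi> (SOME ys. mset ys = N)\<close>, found by
    unification in the final \<open>show\<close>: \<open>\<phi>\<close> is read off at a chosen
    rearrangement of \<open>xs\<close>.\<close>
  define ys where "ys = (SOME ys. mset ys = mset xs)"
  have "mset ys = mset xs" unfolding ys_def by (rule someI[of _ xs]) simp
  then obtain p where "p permutes {..<length xs}" "permute_list p xs = ys"
    by (rule mset_eq_permutation)
  then show "\<phi> xs = \<phi> (SOME ys. mset ys = mset xs)"
    using assms xs unfolding symmetric_fun_def ys_def[symmetric] by (auto simp: tuples_def)
qed

lemma values_on_Icc: "mset (map x [m..<Suc n]) = values_on x {m..n}"
  by (simp add: atLeastLessThanSuc_atLeastAtMost del: upt_Suc)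

text \<open>Exchangeability is built into \<open>law\<close>, whose right-hand side sees only the
  multiset of \<open>xs\<close>.\<close>

locale urn_process = two_stage_urn D c\<^sub>0 B \<pi> \<nu> + prob_space M
  for D :: "'d set" and c\<^sub>0 B \<pi> \<nu> and M :: "'w measure" +
  fixes X :: "nat \<Rightarrow> 'w \<Rightarrow> 'd"
  assumes measurable_X: "n \<ge> 1 \<Longrightarrow> X n \<in> measurable M (count_space D)"
    and law: "n \<ge> 1 \<Longrightarrow> xs \<in> tuples D n \<Longrightarrow>
      measure M {\<omega>\<in>space M. block X 1 n \<omega> = xs} = weight (mset xs)"
begin

lemma X_in_D: "n \<ge> 1 \<Longrightarrow> \<omega> \<in> space M \<Longrightarrow> X n \<omega> \<in> D"
  using measurable_space[OF measurable_X] by simp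

lemma sets_X_eq: "n \<ge> 1 \<Longrightarrow> {\<omega>\<in>space M. X n \<omega> = c} \<in> sets M"
proof -
  assume n: "n \<ge> 1"
  show ?thesis
  proof (cases "c \<in> D")
    case True
    then show ?thesis
      using measurable_sets[OF measurable_X[OF n], of "{c}"] by (simp add: vimage_def Int_def conj_commute)
  next
    case False
    then have "{\<omega>\<in>space M. X n \<omega> = c} = {}" using X_in_D[OF n] by auto
    then show ?thesis by (simp only: sets.empty_sets)
  qed
qed

lemma block_eq_iff: "block X m n \<omega> = map x [m..<Suc n] \<longleftrightarrow> (\<forall>i\<in>{m..n}. X i \<omega> = x i)"
  by (auto simp: block_def simp del: upt_Suc)

lemma block_in_tuples: "m \<ge> 1 \<Longrightarrow> \<omega> \<in> space M \<Longrightarrow> block X m n \<omega> \<in> tuples D (Suc n - m)"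
  by (auto simp: block_def tuples_def X_in_D simp del: upt_Suc)

text \<open>The sample space is partitioned by the finitely many values of the first
  \<open>n\<close> terms. Using \<open>has_bochner_integral\<close> gives measurability and
  integrability along with the value.\<close>

lemma integral_coordinates:
  fixes h :: "(nat \<Rightarrow> 'd) \<Rightarrow> real"
  assumes "n \<ge> 1" "\<And>x. h (restrict x {1..n}) = h x"
  shows "has_bochner_integral M (\<lambda>\<omega>. h (\<lambda>i. X i \<omega>))
    (\<Sum>x\<in>PiE {1..n} (\<lambda>_. D). weight (values_on x {1..n}) * h x)"
proof -
  let ?P = "PiE {1..n} (\<lambda>_. D)"
  define E where "E x = {\<omega>\<in>space M. \<forall>i\<in>{1..n}. X i \<omega> = x i}" for x
  have E: "E x \<in> sets M" for x
    unfolding E_def by (rule sets.sets_Collect_finite_All') (use assms(1) sets_X_eq in auto)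
  have mE: "measure M (E x) = weight (values_on x {1..n})" if "x \<in> ?P" for x
  proof -
    have "map x [1..<Suc n] \<in> tuples D n"
      using that by (auto simp: tuples_def PiE_iff simp del: upt_Suc)
    from law[OF assms(1) this] show ?thesis
      unfolding block_eq_iff values_on_Icc E_def .
  qed
  have finP: "finite ?P" using finite_D by (simp add: finite_PiE)
  have "has_bochner_integral M (\<lambda>\<omega>. \<Sum>x\<in>?P. h x * indicator (E x) \<omega>) (\<Sum>x\<in>?P. h x * measure M (E x))"
    using E by (intro has_bochner_integral_sum has_bochner_integral_mult_right
        has_bochner_integral_real_indicator) (auto simp: emeasure_finite less_top[symmetric])
  also have "(\<Sum>x\<in>?P. h x * measure M (E x)) = (\<Sum>x\<in>?P. weight (values_on x {1..n}) * h x)"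
    using mE by (intro sum.cong) auto
  finally show ?thesis
  proof (rule has_bochner_integral_cong[THEN iffD1, rotated -1])
    fix \<omega> assume w: "\<omega> \<in> space M"
    let ?y = "restrict (\<lambda>i. X i \<omega>) {1..n}"
    have y: "?y \<in> ?P" using X_in_D w by auto
    have "indicator (E x) \<omega> = (if x = ?y then 1 else 0 :: real)" if "x \<in> ?P" for x
    proof -
      have "x = ?y \<longleftrightarrow> (\<forall>i\<in>{1..n}. X i \<omega> = x i)"
        using PiE_ext[OF that y] by auto
      then show ?thesis using w by (simp add: E_def indicator_def)
    qed
    then have "(\<Sum>x\<in>?P. h x * indicator (E x) \<omega>) = (\<Sum>x\<in>?P. if x = ?y then h ?y else 0)"
      by (intro sum.cong) auto
    also have "\<dots> = h ?y" using finP y by simp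
    finally show "(\<Sum>x\<in>?P. h x * indicator (E x) \<omega>) = h (\<lambda>i. X i \<omega>)"
      using assms(2) by simp
  qed simp_all
qed

lemma ustat_restrict: "ustat S k f (restrict x S) = ustat S k f x"
proof -
  have "values_on (restrict x S) J = values_on x J" if "J \<subseteq> S" for J
    using that by (cases "finite J") (auto intro!: image_mset_cong)
  then show ?thesis unfolding ustat_def by (intro sum.cong) auto
qed

lemma integral_ustat_product:
  assumes "n \<ge> 1"
  shows "has_bochner_integral M (\<lambda>\<omega>. ustat {1..n} k f (\<lambda>i. X i \<omega>) * ustat {1..n} r h (\<lambda>i. X i \<omega>))
    (urn_ip {1..n} (ustat {1..n} k f) (ustat {1..n} r h))"
  unfolding urn_ip_def using assms by (intro integral_coordinates) (simp_all only: ustat_restrict)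

lemma borel_measurable_ustat:
  assumes "n \<ge> 1"
  shows "(\<lambda>\<omega>. ustat {1..n} k f (\<lambda>i. X i \<omega>)) \<in> borel_measurable M"
  using integral_coordinates[OF assms, of "ustat {1..n} k f", OF ustat_restrict]
  by (rule borel_measurable_has_bochner_integral)

lemma U_stat_eq_ustat:
  assumes "\<forall>xs\<in>tuples D k. \<phi> xs = f (mset xs)" "\<omega> \<in> space M"
  shows "U_stat X n k \<phi> \<omega> = ustat {1..n} k f (\<lambda>i. X i \<omega>)"
  unfolding U_stat_def ustat_def
proof (rule sum.cong[OF refl])
  fix J assume "J \<in> {J. J \<subseteq> {1..n} \<and> card J = k}"
  then have J: "J \<subseteq> {1..n}" "card J = k" "finite J" by (auto dest: finite_subset)
  then have "map (\<lambda>j. X j \<omega>) (sorted_list_of_set J) \<in> tuples D k"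
    using X_in_D assms(2) by (auto simp: tuples_def)
  then show "\<phi> (map (\<lambda>j. X j \<omega>) (sorted_list_of_set J)) = f (values_on (\<lambda>i. X i \<omega>) J)"
    using assms(1) mset_set_set[OF distinct_sorted_list_of_set, of J] J by simp
qed

section \<open>The spaces \<open>SU\<close> and \<open>SH\<close> in terms of multiset
  kernels\<close>

text \<open>With multiset kernels the order 0 is no exception: such a statistic is the constant
  \<open>h {#}\<close>.\<close>

lemma SU_iff:
  assumes "n \<ge> 1"
  shows "G \<in> SU M D X n r \<longleftrightarrow> G \<in> borel_measurable M \<and>
    (\<exists>h. AE \<omega> in M. G \<omega> = ustat {1..n} r h (\<lambda>i. X i \<omega>))"
proof (cases "r = 0")
  case True
  have "(\<exists>c. AE \<omega> in M. G \<omega> = c) \<longleftrightarrow> (\<exists>h :: 'd multiset \<Rightarrow> real. AE \<omega> in M. G \<omega> = h {#})"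
    by (auto intro: exI[of _ "\<lambda>_ :: 'd multiset. _ :: real"])
  then show ?thesis using True by (simp add: SU_def ustat_zero)
next
  case False
  have "(\<exists>\<phi>. symmetric_fun D r \<phi> \<and> (AE \<omega> in M. G \<omega> = U_stat X n r \<phi> \<omega>)) \<longleftrightarrow>
      (\<exists>h. AE \<omega> in M. G \<omega> = ustat {1..n} r h (\<lambda>i. X i \<omega>))"
  proof
    assume "\<exists>\<phi>. symmetric_fun D r \<phi> \<and> (AE \<omega> in M. G \<omega> = U_stat X n r \<phi> \<omega>)"
    then obtain \<phi> f where f: "\<forall>xs\<in>tuples D r. \<phi> xs = f (mset xs)" and "AE \<omega> in M. G \<omega> = U_stat X n r \<phi> \<omega>"
      using symmetric_fun_imp_mset by blast
    from this(2) AE_space have "AE \<omega> in M. G \<omega> = ustat {1..n} r f (\<lambda>i. X i \<omega>)"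
      by eventually_elim (simp add: U_stat_eq_ustat[OF f])
    then show "\<exists>h. AE \<omega> in M. G \<omega> = ustat {1..n} r h (\<lambda>i. X i \<omega>)" by blast
  next
    assume "\<exists>h. AE \<omega> in M. G \<omega> = ustat {1..n} r h (\<lambda>i. X i \<omega>)"
    then obtain h where "AE \<omega> in M. G \<omega> = ustat {1..n} r h (\<lambda>i. X i \<omega>)" by blast
    from this AE_space have "AE \<omega> in M. G \<omega> = U_stat X n r (\<lambda>xs. h (mset xs)) \<omega>"
      by eventually_elim (simp add: U_stat_eq_ustat[where f = h])
    then show "\<exists>\<phi>. symmetric_fun D r \<phi> \<and> (AE \<omega> in M. G \<omega> = U_stat X n r \<phi> \<omega>)"
      using symmetric_fun_mset by blast
  qed
  then show ?thesis using False by (simp add: SU_def)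
qed

text \<open>A U-statistic always lies in \<open>SU\<close> and, being a function of the multiset of
  the sample, in \<open>L_s\<close>. Only orthogonality to the statistics of order \<open>r\<close>
  is left.\<close>

lemma U_stat_in_SH_iff:
  assumes "n \<ge> 1" "Suc r \<le> n" and f: "\<forall>xs\<in>tuples D (Suc r). \<phi> xs = f (mset xs)"
  shows "U_stat X n (Suc r) \<phi> \<in> SH M D X n (Suc r) \<longleftrightarrow>
    (\<forall>h. urn_ip {1..n} (ustat {1..n} (Suc r) f) (ustat {1..n} r h) = 0)"
proof -
  let ?F = "U_stat X n (Suc r) \<phi>" and ?F' = "\<lambda>\<omega>. ustat {1..n} (Suc r) f (\<lambda>i. X i \<omega>)"
  let ?G = "\<lambda>h \<omega>. ustat {1..n} r h (\<lambda>i. X i \<omega>)"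
  have FF': "?F \<omega> = ?F' \<omega>" if "\<omega> \<in> space M" for \<omega>
    using U_stat_eq_ustat[OF f that] .
  have meas: "?F \<in> borel_measurable M"
    using borel_measurable_ustat[OF assms(1), of "Suc r" f] FF' by (simp cong: measurable_cong)
  have "?F \<in> SU M D X n (Suc r)"
    unfolding SU_iff[OF assms(1)] using meas FF' by auto
  moreover have "?F \<in> L_s M D X n"
  proof -
    obtain g where g: "\<And>x. ustat {1..n} (Suc r) f x = g (values_on x {1..n})"
      using ustat_eq_multiset_fun[of "{1..n}" "Suc r" f] assms(2) by auto
    have "?F \<omega> = g (mset (block X 1 n \<omega>))" if "\<omega> \<in> space M" for \<omega>
      unfolding FF'[OF that] g block_def values_on_Icc ..
    then show ?thesis
      using meas symmetric_fun_mset[of D n g] unfolding L_s_def by blast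
  qed
  moreover have "(\<forall>G\<in>SU M D X n r. (\<integral>\<omega>. ?F \<omega> * G \<omega> \<partial>M) = 0) \<longleftrightarrow>
      (\<forall>h. urn_ip {1..n} (ustat {1..n} (Suc r) f) (ustat {1..n} r h) = 0)"
  proof -
    have int: "(\<integral>\<omega>. ?F \<omega> * G \<omega> \<partial>M) = urn_ip {1..n} (ustat {1..n} (Suc r) f) (ustat {1..n} r h)"
      if "G \<in> borel_measurable M" "AE \<omega> in M. G \<omega> = ?G h \<omega>" for G h
    proof -
      have "(\<integral>\<omega>. ?F \<omega> * G \<omega> \<partial>M) = (\<integral>\<omega>. ?F' \<omega> * ?G h \<omega> \<partial>M)"
      proof (rule integral_cong_AE)
        show "AE \<omega> in M. ?F \<omega> * G \<omega> = ?F' \<omega> * ?G h \<omega>"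
          using that(2) AE_space by eventually_elim (simp add: FF')
      qed (use that(1) meas borel_measurable_ustat[OF assms(1)] in auto)
      also have "\<dots> = urn_ip {1..n} (ustat {1..n} (Suc r) f) (ustat {1..n} r h)"
        using integral_ustat_product[OF assms(1)] by (rule has_bochner_integral_integral_eq)
      finally show ?thesis .
    qed
    show ?thesis
    proof (intro iffI allI ballI)
      fix h assume all: "\<forall>G\<in>SU M D X n r. (\<integral>\<omega>. ?F \<omega> * G \<omega> \<partial>M) = 0"
      have "?G h \<in> SU M D X n r"
        unfolding SU_iff[OF assms(1)] using borel_measurable_ustat[OF assms(1)] by auto
      from bspec[OF all this] have "(\<integral>\<omega>. ?F \<omega> * ?G h \<omega> \<partial>M) = 0" .
      moreover have "(\<integral>\<omega>. ?F \<omega> * ?G h \<omega> \<partial>M) = urn_ip {1..n} (ustat {1..n} (Suc r) f) (ustat {1..n} r h)"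
        using borel_measurable_ustat[OF assms(1)] by (intro int) auto
      ultimately show "urn_ip {1..n} (ustat {1..n} (Suc r) f) (ustat {1..n} r h) = 0" by simp
    next
      fix G assume "\<forall>h. urn_ip {1..n} (ustat {1..n} (Suc r) f) (ustat {1..n} r h) = 0"
        and "G \<in> SU M D X n r"
      then show "(\<integral>\<omega>. ?F \<omega> * G \<omega> \<partial>M) = 0"
        unfolding SU_iff[OF assms(1)] using int by metis
    qed
  qed
  ultimately show ?thesis by (simp add: SH_def orth_compl_def)
qed

section \<open>Complete degeneracy as a condition on marginals\<close>

text \<open>These expectations against test functions \<open>a\<close> of the conditioning block
  determine the conditional expectation; the coordinate 1 is the one summed out.\<close>

lemma integral_block:
  fixes a :: "'d list \<Rightarrow> real"
  assumes f: "\<forall>xs\<in>tuples D (Suc r). \<phi> xs = f (mset xs)"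
  shows "has_bochner_integral M (\<lambda>\<omega>. a (block X 2 (Suc r) \<omega>) * \<phi> (block X 1 (Suc r) \<omega>))
    (\<Sum>x\<in>PiE {2..Suc r} (\<lambda>_. D). a (map x [2..<Suc (Suc r)]) *
      (\<Sum>c\<in>D. weight (add_mset c (values_on x {2..Suc r})) * f (add_mset c (values_on x {2..Suc r}))))"
proof -
  define h where "h x = a (map x [2..<Suc (Suc r)]) * f (values_on x {1..Suc r})" for x
  have S: "{1..Suc r} = insert 1 {2..Suc r}" "1 \<notin> {2..Suc r}" by auto
  have map_cong: "map x [2..<Suc (Suc r)] = map y [2..<Suc (Suc r)]" if "\<And>i. i \<in> {2..Suc r} \<Longrightarrow> x i = y i" for x y
    using that by (intro map_cong) auto
  have "h (restrict x {1..Suc r}) = h x" for x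
    unfolding h_def by (intro arg_cong2[where f = "(*)"] arg_cong[where f = a] arg_cong[where f = f] map_cong image_mset_cong) auto
  then have "has_bochner_integral M (\<lambda>\<omega>. h (\<lambda>i. X i \<omega>))
      (\<Sum>x\<in>PiE {1..Suc r} (\<lambda>_. D). weight (values_on x {1..Suc r}) * h x)"
    by (intro integral_coordinates) auto
  also have "(\<Sum>x\<in>PiE {1..Suc r} (\<lambda>_. D). weight (values_on x {1..Suc r}) * h x) =
      (\<Sum>x\<in>PiE {2..Suc r} (\<lambda>_. D). \<Sum>c\<in>D. weight (values_on (x(1 := c)) {1..Suc r}) * h (x(1 := c)))"
    unfolding S(1) by (rule sum_PiE_insert[OF S(2)])
  also have "\<dots> = (\<Sum>x\<in>PiE {2..Suc r} (\<lambda>_. D). a (map x [2..<Suc (Suc r)]) *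
      (\<Sum>c\<in>D. weight (add_mset c (values_on x {2..Suc r})) * f (add_mset c (values_on x {2..Suc r}))))"
  proof (rule sum.cong[OF refl])
    fix x assume "x \<in> PiE {2..Suc r} (\<lambda>_. D)"
    have 1: "values_on (x(1 := c)) {1..Suc r} = add_mset c (values_on x {2..Suc r})" for c
    proof -
      have "{1..Suc r} - {1} = {2..Suc r}" by auto
      then show ?thesis using values_on_fun_upd_in[of "{1..Suc r}" 1 x c] by (simp only:) simp
    qed
    have 2: "map (x(1 := c)) [2..<Suc (Suc r)] = map x [2..<Suc (Suc r)]" for c
      by (intro map_cong) auto
    show "(\<Sum>c\<in>D. weight (values_on (x(1 := c)) {1..Suc r}) * h (x(1 := c))) = a (map x [2..<Suc (Suc r)]) *
      (\<Sum>c\<in>D. weight (add_mset c (values_on x {2..Suc r})) * f (add_mset c (values_on x {2..Suc r})))"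
      unfolding h_def 1 2 sum_distrib_left by (simp only: mult.left_commute)
  qed
  finally show ?thesis
  proof (rule has_bochner_integral_cong[THEN iffD1, rotated -1])
    fix \<omega> assume w: "\<omega> \<in> space M"
    have "\<phi> (block X 1 (Suc r) \<omega>) = f (mset (block X 1 (Suc r) \<omega>))"
      using f block_in_tuples[OF order_refl w, of "Suc r"] by simp
    then show "h (\<lambda>i. X i \<omega>) = a (block X 2 (Suc r) \<omega>) * \<phi> (block X 1 (Suc r) \<omega>)"
      unfolding h_def by (simp only: block_def values_on_Icc)
  qed simp_all
qed

lemma completely_degenerate_iff:
  assumes f: "\<forall>xs\<in>tuples D (Suc r). \<phi> xs = f (mset xs)"
  shows "completely_degenerate M D X (Suc r) \<phi> \<longleftrightarrow> degenerate r f"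
proof -
  define s where "s N = (\<Sum>c\<in>D. weight (add_mset c N) * f (add_mset c N))" for N
  let ?P = "PiE {2..Suc r} (\<lambda>_. D)" and ?m = "\<lambda>x. map x [2..<Suc (Suc r)]"
  let ?\<phi> = "\<lambda>\<omega>. \<phi> (block X 1 (Suc r) \<omega>)"
  note int = integral_block[OF f, folded s_def]
  have zero: "s (values_on x {2..Suc r}) = 0" if "degenerate r f" "x \<in> ?P" for x
    using that values_on_subset[OF that(2) order_refl] by (simp add: degenerate_def s_def)
  \<comment> \<open>Testing with the indicator of the words that rearrange \<open>N\<close> isolates
    \<open>s N\<close>, counted once per such word.\<close>
  have deg: "degenerate r f" if all: "\<And>a. (\<Sum>x\<in>?P. a (?m x) * s (values_on x {2..Suc r})) = 0"
  proof -
    have "s N = 0" if N: "size N = r" "set_mset N \<subseteq> D" for N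
    proof -
      have fin: "finite ?P" using finite_D by (simp add: finite_PiE)
      have "0 = (\<Sum>x\<in>?P. (if mset (?m x) = N then 1 else 0) * s (values_on x {2..Suc r}))"
        using all[of "\<lambda>ys. if mset ys = N then 1 else 0"] by simp
      also have "\<dots> = (\<Sum>x\<in>?P. if values_on x {2..Suc r} = N then s N else 0)"
        unfolding values_on_Icc by (intro sum.cong) auto
      also have "\<dots> = real (card {x\<in>?P. values_on x {2..Suc r} = N}) * s N"
        using fin by (simp add: sum.If_cases Int_def)
      finally have "real (card {x\<in>?P. values_on x {2..Suc r} = N}) * s N = 0" by simp
      moreover have "{x\<in>?P. values_on x {2..Suc r} = N} \<noteq> {}"
        using ex_values_on[of "{2..Suc r}" N D] N by auto
      then have "card {x\<in>?P. values_on x {2..Suc r} = N} \<noteq> 0" using fin by simp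
      ultimately show ?thesis by simp
    qed
    then show ?thesis by (simp add: degenerate_def s_def)
  qed
  show ?thesis
  proof (cases "r = 0")
    case True
    \<comment> \<open>With nothing to condition on, \<open>{2..Suc r}\<close> is empty and the mean
      of the kernel is \<open>s {#}\<close>.\<close>
    have "(\<integral>\<omega>. ?\<phi> \<omega> \<partial>M) = (\<Sum>x\<in>?P. s (values_on x {2..Suc r}))"
      using has_bochner_integral_integral_eq[OF int[of "\<lambda>_. 1"]] by simp
    also have "\<dots> = s {#}" using True by simp
    finally have "(\<integral>\<omega>. ?\<phi> \<omega> \<partial>M) = s {#}" .
    then show ?thesis using True by (simp add: completely_degenerate_def degenerate_def s_def)
  next
    case False
    define T where "T = tuples D r"
    define F where "F = vimage_algebra (space M) (block X 2 (Suc r)) (count_space T)"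
    have bT: "block X 2 (Suc r) \<in> space M \<rightarrow> T"
      using block_in_tuples[of 2 _ "Suc r"] by (auto simp: T_def)
    have finT: "finite T"
      using finite_lists_length_eq[OF finite_D, of r] by (simp add: T_def tuples_def conj_commute)
    have sets_F: "sets F = {block X 2 (Suc r) -` A \<inter> space M |A. A \<subseteq> T}"
      unfolding F_def using sets_vimage_algebra2[of "block X 2 (Suc r)" "space M" "count_space T"] bT by simp
    have "block X 2 (Suc r) \<in> measurable M (count_space T)"
      unfolding measurable_count_space_eq2[OF finT]
    proof (intro conjI ballI bT)
      fix ys assume "ys \<in> T"
      then have len: "length ys = r" by (simp add: T_def tuples_def)
      have "block X 2 (Suc r) \<omega> = ys \<longleftrightarrow> (\<forall>i\<in>{2..Suc r}. X i \<omega> = ys ! (i - 2))" for \<omega>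
      proof -
        have "ys = map (\<lambda>i. ys ! (i - 2)) [2..<Suc (Suc r)]"
          using len by (intro nth_equalityI) (auto simp del: upt_Suc)
        then show ?thesis using block_eq_iff[of 2 "Suc r" \<omega> "\<lambda>i. ys ! (i - 2)"] by simp
      qed
      then have "block X 2 (Suc r) -` {ys} \<inter> space M = {\<omega>\<in>space M. \<forall>i\<in>{2..Suc r}. X i \<omega> = ys ! (i - 2)}"
        by auto
      also have "\<dots> \<in> sets M"
        by (rule sets.sets_Collect_finite_All') (use False sets_X_eq in auto)
      finally show "block X 2 (Suc r) -` {ys} \<inter> space M \<in> sets M" .
    qed
    then have sub: "subalgebra M F"
      unfolding subalgebra_def sets_F using measurable_sets[of "block X 2 (Suc r)" M "count_space T"]
      by (auto simp: F_def)
    interpret F: sigma_finite_subalgebra M F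
      using sub by (intro finite_measure_subalgebra_is_sigma_finite) (unfold_locales)
    have integrable: "integrable M ?\<phi>"
      using integrable.intros[OF int[of "\<lambda>_. 1"]] by simp
    have set_int: "(\<integral>\<omega>\<in>block X 2 (Suc r) -` A \<inter> space M. ?\<phi> \<omega> \<partial>M) =
        (\<Sum>x\<in>?P. indicator A (?m x) * s (values_on x {2..Suc r}))" for A
    proof -
      have "(\<integral>\<omega>\<in>block X 2 (Suc r) -` A \<inter> space M. ?\<phi> \<omega> \<partial>M) =
          (\<integral>\<omega>. indicator A (block X 2 (Suc r) \<omega>) * ?\<phi> \<omega> \<partial>M)"
        unfolding set_lebesgue_integral_def
        by (intro Bochner_Integration.integral_cong) (auto simp: indicator_def)
      then show ?thesis using has_bochner_integral_integral_eq[OF int[of "indicator A"]] by simp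
    qed
    have "completely_degenerate M D X (Suc r) \<phi> \<longleftrightarrow> (AE \<omega> in M. real_cond_exp M F ?\<phi> \<omega> = 0)"
      using False by (simp add: completely_degenerate_def F_def T_def)
    also have "\<dots> \<longleftrightarrow> degenerate r f"
    proof
      assume AE: "AE \<omega> in M. real_cond_exp M F ?\<phi> \<omega> = 0"
      show "degenerate r f"
      proof (rule deg)
        fix a :: "'d list \<Rightarrow> real"
        \<comment> \<open>The events fixing the block to one word \<open>ys\<close> belong to
          \<open>F\<close>. A general \<open>a\<close> is a finite combination of their
          indicators.\<close>
        have single: "(\<Sum>x\<in>?P. indicator {ys} (?m x) * s (values_on x {2..Suc r})) = 0" if "ys \<in> T" for ys
        proof -
          define A where "A = block X 2 (Suc r) -` {ys} \<inter> space M"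
          have A: "A \<in> sets F" unfolding sets_F A_def using that by auto
          have "(\<integral>\<omega>\<in>A. ?\<phi> \<omega> \<partial>M) = (\<integral>\<omega>\<in>A. real_cond_exp M F ?\<phi> \<omega> \<partial>M)"
            by (rule F.real_cond_exp_intA[OF integrable A])
          also have "\<dots> = 0"
            unfolding set_lebesgue_integral_def using AE by (intro integral_eq_zero_AE) auto
          finally show ?thesis unfolding A_def set_int .
        qed
        have "(\<Sum>x\<in>?P. a (?m x) * s (values_on x {2..Suc r})) =
            (\<Sum>x\<in>?P. \<Sum>ys\<in>T. a ys * (indicator {ys} (?m x) * s (values_on x {2..Suc r})))"
        proof (rule sum.cong[OF refl])
          fix x assume "x \<in> ?P"
          then have "?m x \<in> T" by (auto simp: T_def tuples_def PiE_iff simp del: upt_Suc)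
          then show "a (?m x) * s (values_on x {2..Suc r}) =
              (\<Sum>ys\<in>T. a ys * (indicator {ys} (?m x) * s (values_on x {2..Suc r})))"
            using finT by (subst sum.remove[of T "?m x"]) (auto intro!: sum.neutral simp: indicator_def)
        qed
        also have "\<dots> = (\<Sum>ys\<in>T. \<Sum>x\<in>?P. a ys * (indicator {ys} (?m x) * s (values_on x {2..Suc r})))"
          by (rule sum.swap)
        also have "\<dots> = 0"
          using single by (simp only: sum_distrib_left[symmetric]) simp
        finally show "(\<Sum>x\<in>?P. a (?m x) * s (values_on x {2..Suc r})) = 0" .
      qed
    next
      assume d: "degenerate r f"
      show "AE \<omega> in M. real_cond_exp M F ?\<phi> \<omega> = 0"
      \<comment> \<open>The zero function has the averaging property over every event of
        \<open>F\<close>, since all marginals \<open>s\<close> vanish.\<close>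
      proof (rule F.real_cond_exp_charact)
        fix A assume "A \<in> sets F"
        then obtain A' where "A = block X 2 (Suc r) -` A' \<inter> space M" unfolding sets_F by auto
        then show "(\<integral>\<omega>\<in>A. ?\<phi> \<omega> \<partial>M) = (\<integral>\<omega>\<in>A. 0 \<partial>M)"
          using set_int[of A'] zero[OF d] by (simp add: set_lebesgue_integral_def)
      qed (use integrable in auto)
    qed
    finally show ?thesis .
  qed
qed

lemma hoeffding_decomposable: "Hoeffding_decomposable M D X"
  unfolding Hoeffding_decomposable_def
proof (intro allI impI ballI)
  fix n k :: nat and \<phi> assume n: "n \<ge> 2" and k: "k \<in> {1..n}" and "symmetric_fun D k \<phi>"
  then obtain f r where f: "\<forall>xs\<in>tuples D (Suc r). \<phi> xs = f (mset xs)" and r: "k = Suc r"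
    using symmetric_fun_imp_mset by (metis One_nat_def atLeastAtMost_iff not0_implies_Suc not_one_le_zero)
  have "U_stat X n k \<phi> \<in> SH M D X n k \<longleftrightarrow> degenerate r f"
    unfolding r using U_stat_in_SH_iff[OF _ _ f, of n] degenerate_iff_ustat_orthogonal[of "{1..n}" r f] n k r
    by simp
  then show "U_stat X n k \<phi> \<in> SH M D X n k \<longleftrightarrow> completely_degenerate M D X k \<phi>"
    unfolding r completely_degenerate_iff[OF f] by simp
qed

section \<open>Dependence of the first two terms\<close>

text \<open>Independence of the events \<open>X 1 = c\<^sub>0\<close> and
  \<open>X 2 = c\<^sub>0\<close> would give
  \<open>(\<pi> + 1) * (\<pi> + \<nu>) = \<pi> * (\<pi> + \<nu> + 1)\<close>, that is,
  \<open>\<nu> = 0\<close>.\<close>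

lemma not_iid: "\<not> iid_sequence M D X"
proof
  assume "iid_sequence M D X"
  then have indep: "indep_vars (\<lambda>_. count_space D) X {1..}" by (simp add: iid_sequence_def)
  define E where "E i = {\<omega>\<in>space M. X i \<omega> = c\<^sub>0}" for i
  have "prob (\<Inter>i\<in>{1,2}. X i -` {c\<^sub>0} \<inter> space M) = (\<Prod>i\<in>{1,2}. prob (X i -` {c\<^sub>0} \<inter> space M))"
    using c0_in_D by (intro indep_varsD[OF indep]) auto
  moreover have "X i -` {c\<^sub>0} \<inter> space M = E i" for i by (auto simp: E_def)
  ultimately have E12: "prob (E 1 \<inter> E 2) = prob (E 1) * prob (E 2)" by simp
  have u: "{1::nat} \<union> {2} = {1..2}" by auto
  have "{\<omega>\<in>space M. block X 1 1 \<omega> = [c\<^sub>0]} = E 1"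
    by (auto simp: E_def block_def)
  then have e1: "prob (E 1) = \<pi> / (\<pi> + \<nu>)"
    using law[of 1 "[c\<^sub>0]"] c0_in_D by (simp add: tuples_def weight_def B_c0)
  have b2: "block X 1 2 \<omega> = [X 1 \<omega>, X 2 \<omega>]" for \<omega>
    by (simp add: block_def upt_rec numeral_2_eq_2)
  have "{\<omega>\<in>space M. block X 1 2 \<omega> = [c\<^sub>0, c\<^sub>0]} = E 1 \<inter> E 2"
    by (auto simp: E_def b2[unfolded One_nat_def])
  then have e12: "prob (E 1 \<inter> E 2) = \<pi> * (\<pi> + 1) / ((\<pi> + \<nu>) * (\<pi> + \<nu> + 1))"
    using law[of 2 "[c\<^sub>0, c\<^sub>0]"] c0_in_D
    by (simp add: tuples_def weight_def B_c0 pochhammer_Suc numeral_2_eq_2)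
  \<comment> \<open>The term \<open>X 2\<close> alone is not an initial block, so its law is
    obtained by summing out \<open>X 1\<close>.\<close>
  have "has_bochner_integral M (\<lambda>\<omega>. if X 2 \<omega> = c\<^sub>0 then 1 else 0 :: real)
     (\<Sum>x\<in>PiE {1..2::nat} (\<lambda>_. D). weight (values_on x {1..2}) * (if x 2 = c\<^sub>0 then 1 else 0))"
    by (rule integral_coordinates) auto
  moreover have "(\<Sum>x\<in>PiE {1..2::nat} (\<lambda>_. D). weight (values_on x {1..2}) * (if x 2 = c\<^sub>0 then 1 else 0)) =
      (\<Sum>x\<in>PiE {2::nat} (\<lambda>_. D). weight (values_on x {2}) * (if x 2 = c\<^sub>0 then 1 else 0))"
    using sum_weight_marginal[of "{1::nat}" "{2}" "\<lambda>x. if x 2 = c\<^sub>0 then 1 else 0", unfolded u] by simp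
  moreover have "\<dots> = weight {#c\<^sub>0#}"
    using sum_PiE_insert[of 2 "{}" "\<lambda>x. weight (values_on x {2::nat}) * (if x 2 = c\<^sub>0 then 1 else 0)" D]
      finite_D c0_in_D by (simp add: if_distrib sum.delta cong: if_cong)
  moreover have "has_bochner_integral M (\<lambda>\<omega>. if X 2 \<omega> = c\<^sub>0 then 1 else 0 :: real) (prob (E 2))"
  proof -
    have "has_bochner_integral M (indicator (E 2)) (prob (E 2))"
      using sets_X_eq[of 2 c\<^sub>0] by (intro has_bochner_integral_real_indicator) (auto simp: E_def less_top[symmetric])
    then show ?thesis
      by (rule has_bochner_integral_cong[THEN iffD1, rotated -1]) (auto simp: E_def)
  qed
  ultimately have "prob (E 2) = weight {#c\<^sub>0#}"
    by (metis has_bochner_integral_eq)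
  then have "prob (E 2) = \<pi> / (\<pi> + \<nu>)" by (simp add: weight_def B_c0)
  with E12 e1 e12 have "\<pi> * (\<pi> + 1) / ((\<pi> + \<nu>) * (\<pi> + \<nu> + 1)) = \<pi> / (\<pi> + \<nu>) * (\<pi> / (\<pi> + \<nu>))" by simp
  then have "(\<pi> + 1) * (\<pi> + \<nu>) = \<pi> * (\<pi> + \<nu> + 1)"
    using pi_pos nu_pos by (simp add: divide_simps add_pos_pos)
  then show False using nu_pos by (simp add: algebra_simps)
qed

end


section \<open>Moments of the HLS measure\<close>

lemma Beta_ratio:
  fixes a b :: real
  assumes "a > 0" "b > 0"
  shows "Beta (a + real i) (b + real j) / Beta a b = pochhammer a i * pochhammer b j / pochhammer (a + b) (i + j)"
proof -
  have pos: "Gamma a > 0" "Gamma b > 0" "Gamma (a + b) > 0"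
      "Gamma (a + b + real (i + j)) > 0"
    using assms by (simp_all add: Gamma_real_pos)
  have notin: "z \<notin> \<int>\<^sub>\<le>\<^sub>0" if "z > 0" for z :: real
    using that by (auto simp: nonpos_Ints_def)
  have p: "pochhammer a i = Gamma (a + real i) / Gamma a"
       "pochhammer b j = Gamma (b + real j) / Gamma b"
       "pochhammer (a + b) (i + j) = Gamma (a + b + real (i + j)) / Gamma (a + b)"
    using assms by (intro pochhammer_Gamma notin; simp)+
  have s: "a + real i + (b + real j) = a + b + real (i + j)" by simp
  show ?thesis
    unfolding Beta_def p s using pos by (simp add: divide_simps)
qed

text \<open>On the support of the HLS measure each coordinate with \<open>j \<ge> 2\<close>,
  including the implicit last one, is this weight times \<open>1 - \<theta> 1\<close>. The entry 1
  at \<open>j = 1\<close> fits the convention \<open>B c\<^sub>0 = 1\<close>.\<close>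

definition simplex_color_weight :: "nat \<Rightarrow> (nat \<Rightarrow> real) \<Rightarrow> nat \<Rightarrow> real" where
  "simplex_color_weight K \<alpha> j =
    (if j = 1 then 1 else if j = K then 1 - (\<Sum>i=1..K-2. \<alpha> i) else \<alpha> (j - 1))"

lemma sum_alpha_shift:
  fixes K :: nat and \<alpha> :: "nat \<Rightarrow> real"
  assumes "K \<ge> 3"
  shows "(\<Sum>h=2..K-1. \<alpha> (h - 1)) = (\<Sum>i=1..K-2. \<alpha> i)"
  by (rule sum.reindex_bij_witness[of _ Suc "\<lambda>h. h - 1"]) (use assms in auto)

lemma sum_simplex_color_weight:
  assumes "K \<ge> 3"
  shows "(\<Sum>j=2..K. simplex_color_weight K \<alpha> j) = 1"
proof -
  have K: "{2..K} = insert K {2..K-1}" "K \<notin> {2..K-1}" using assms by auto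
  have "(\<Sum>j=2..K-1. simplex_color_weight K \<alpha> j) = (\<Sum>j=2..K-1. \<alpha> (j - 1))"
    by (intro sum.cong) (auto simp: simplex_color_weight_def)
  then show ?thesis
    unfolding K(1) using K(2) assms sum_alpha_shift[OF assms, of \<alpha>] by (simp add: simplex_color_weight_def)
qed

lemma measurable_Theta_borel_component:
  assumes "h \<in> {1..K-1}"
  shows "(\<lambda>\<theta>. \<theta> h) \<in> borel_measurable (Theta_borel K)"
  unfolding Theta_borel_def using assms
  by (intro measurable_restrict_space1 measurable_component_singleton) 

text \<open>Pulled back to the first coordinate \<open>t\<close>, the integrand is a constant times
  \<open>t ^ m 1\<close> and a power of \<open>1 - t\<close>. What remains is a Beta integral with
  both parameters shifted by the counts.\<close>

lemma integral_HLS_measure: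
  fixes m :: "nat \<Rightarrow> nat"
  assumes K: "K \<ge> 3" and pos: "\<pi> > 0" "\<nu> > 0"
    and \<alpha>: "\<And>i. i \<in> {1..K-2} \<Longrightarrow> \<alpha> i > 0" and sum_\<alpha>: "(\<Sum>i=1..K-2. \<alpha> i) < 1"
  shows "(\<integral>\<theta>. (\<Prod>j=1..K-1. \<theta> j ^ m j) * (1 - (\<Sum>h=1..K-1. \<theta> h)) ^ m K \<partial>HLS_measure K \<pi> \<nu> \<alpha>) =
    (\<Prod>j=2..K. simplex_color_weight K \<alpha> j ^ m j) * (pochhammer \<pi> (m 1) * pochhammer \<nu> (\<Sum>j=2..K. m j)
      / pochhammer (\<pi> + \<nu>) (m 1 + (\<Sum>j=2..K. m j)))"
proof -
  let ?b = "simplex_color_weight K \<alpha>" and ?M = "\<Sum>j=2..K. m j"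
  define f where "f = (\<lambda>t::real. \<lambda>j\<in>{1..K-1}. if j = 1 then t else \<alpha> (j - 1) * (1 - t))"
  define g where "g = (\<lambda>t::real. 1 / Beta \<pi> \<nu> * t powr (\<pi> - 1) * (1 - t) powr (\<nu> - 1))"
  define N where "N = restrict_space lborel {0..1::real}"
  define F where "F \<theta> = (\<Prod>j=1..K-1. \<theta> j ^ m j) * (1 - (\<Sum>h=1..K-1. \<theta> h)) ^ m K" for \<theta> :: "nat \<Rightarrow> real"
  have split1: "{1..K-1} = insert 1 {2..K-1}" and split2: "{2..K} = insert K {2..K-1}" "K \<notin> {2..K-1}"
    using K by auto
  have BetaP: "Beta \<pi> \<nu> > 0" using pos by (simp add: Beta_def Gamma_real_pos)
  have f_1: "f t 1 = t" for t using K unfolding f_def by (subst restrict_apply) auto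
  have sum_f: "(\<Sum>h=1..K-1. f t h) = t + (1 - t) * (\<Sum>i=1..K-2. \<alpha> i)" for t
  proof -
    have "(\<Sum>h=2..K-1. f t h) = (\<Sum>h=2..K-1. (1 - t) * \<alpha> (h - 1))"
      by (intro sum.cong) (auto simp: f_def)
    then show ?thesis
      unfolding split1 using f_1[of t] sum_alpha_shift[OF K, of \<alpha>] by (simp add: sum_distrib_left[symmetric])
  qed
  have f_Theta: "f t \<in> Theta K" if "t \<in> {0..1}" for t
  proof -
    have "0 \<le> f t h" if "h \<in> {1..K-1}" for h
      using that \<open>t \<in> {0..1}\<close> by (auto simp: f_def intro!: mult_nonneg_nonneg less_imp_le[OF \<alpha>])
    moreover have "t + (1 - t) * (\<Sum>i=1..K-2. \<alpha> i) \<le> 1"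
      using mult_left_mono[of "\<Sum>i=1..K-2. \<alpha> i" 1 "1 - t"] that sum_\<alpha> by simp
    moreover have "f t \<in> {1..K-1} \<rightarrow>\<^sub>E UNIV" by (auto simp: f_def)
    ultimately show ?thesis using sum_f[of t] by (simp add: Theta_def)
  qed
  have f_meas: "f \<in> measurable N (Theta_borel K)"
    unfolding Theta_borel_def
  proof (rule measurable_restrict_space2)
    show "f \<in> space N \<rightarrow> Theta K" using f_Theta by (auto simp: N_def space_restrict_space)
    show "f \<in> measurable N (PiM {1..K-1} (\<lambda>_. borel))"
      unfolding f_def N_def
      by (intro measurable_restrict measurable_restrict_space1) auto
  qed
  have F_meas: "F \<in> borel_measurable (Theta_borel K)"
    unfolding F_def
    by (intro borel_measurable_times borel_measurable_prod borel_measurable_power borel_measurable_diff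
        borel_measurable_sum borel_measurable_const measurable_Theta_borel_component) auto
  have g_meas: "g \<in> borel_measurable N"
    unfolding g_def N_def by (intro measurable_restrict_space1) measurable
  have g_nonneg: "g t \<ge> 0" for t using BetaP by (simp add: g_def)
  have Ff: "F (f t) = (\<Prod>j=2..K. ?b j ^ m j) * (t ^ m 1 * (1 - t) ^ ?M)" for t
  proof -
    have "(\<Prod>j=2..K-1. f t j ^ m j) = (\<Prod>j=2..K-1. ?b j ^ m j * (1 - t) ^ m j)"
      by (intro prod.cong) (auto simp: f_def simplex_color_weight_def power_mult_distrib)
    also have "\<dots> = (\<Prod>j=2..K-1. ?b j ^ m j) * (1 - t) ^ (\<Sum>j=2..K-1. m j)"
      by (simp add: prod.distrib power_sum)
    finally have p1: "(\<Prod>j=1..K-1. f t j ^ m j) = t ^ m 1 * ((\<Prod>j=2..K-1. ?b j ^ m j) * (1 - t) ^ (\<Sum>j=2..K-1. m j))"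
      unfolding split1 using f_1[of t] by simp
    have p2: "1 - (\<Sum>h=1..K-1. f t h) = ?b K * (1 - t)"
      unfolding sum_f using K by (simp add: simplex_color_weight_def algebra_simps)
    show ?thesis
      unfolding F_def p1 p2 split2(1) using split2(2)
      by (simp add: power_mult_distrib power_add)
  qed
  have gF: "g t * F (f t) = (\<Prod>j=2..K. ?b j ^ m j) / Beta \<pi> \<nu> *
      (t powr (\<pi> + real (m 1) - 1) * (1 - t) powr (\<nu> + real ?M - 1))" if t: "t \<in> {0..1}" for t
  proof -
    \<comment> \<open>At \<open>x = 0\<close> both sides are 0, even for \<open>n = 0\<close>,
      because \<open>0 powr y = 0\<close> for every \<open>y\<close>; so the endpoints need no
      exclusion.\<close>
    have pw: "x powr (a - 1) * x ^ n = x powr (a + real n - 1)" if "x \<ge> 0" for x a :: real and n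
      using that by (cases "x = 0") (simp_all add: powr_realpow[symmetric] powr_add[symmetric] algebra_simps)
    have "g t * F (f t) = (\<Prod>j=2..K. ?b j ^ m j) / Beta \<pi> \<nu> *
        ((t powr (\<pi> - 1) * t ^ m 1) * ((1 - t) powr (\<nu> - 1) * (1 - t) ^ ?M))"
      unfolding Ff g_def by (simp only: times_divide_eq_left times_divide_eq_right mult_ac mult_1)
    then show ?thesis using t by (simp only: pw atLeastAtMost_iff diff_ge_0_iff_ge)
  qed
  have HLS: "HLS_measure K \<pi> \<nu> \<alpha> = distr (density N g) (Theta_borel K) f"
    by (simp only: HLS_measure_def f_def g_def N_def)
  have "(\<integral>\<theta>. F \<theta> \<partial>HLS_measure K \<pi> \<nu> \<alpha>) = (\<integral>t. F (f t) \<partial>density N g)"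
    unfolding HLS
    using f_meas F_meas by (intro integral_distr) simp_all
  also have "\<dots> = (\<integral>t. g t * F (f t) \<partial>N)"
    using measurable_compose[OF f_meas F_meas] g_meas g_nonneg by (subst integral_density) auto
  also have "\<dots> = (LINT t:{0..1}|lborel. g t * F (f t))"
    unfolding N_def set_lebesgue_integral_def by (rule integral_restrict_space) simp
  also have "\<dots> = (LINT t:{0..1}|lborel. (\<Prod>j=2..K. ?b j ^ m j) / Beta \<pi> \<nu> *
      (t powr (\<pi> + real (m 1) - 1) * (1 - t) powr (\<nu> + real ?M - 1)))"
    using gF by (intro set_lebesgue_integral_cong) auto
  also have "\<dots> = (\<Prod>j=2..K. ?b j ^ m j) / Beta \<pi> \<nu> * Beta (\<pi> + real (m 1)) (\<nu> + real ?M)"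
  proof -
    have p: "\<pi> + real (m 1) > 0" "\<nu> + real ?M > 0"
      by (intro add_pos_nonneg pos of_nat_0_le_iff)+
    have "(LINT t:{0..1}|lborel. t powr (\<pi> + real (m 1) - 1) * (1 - t) powr (\<nu> + real ?M - 1)) =
        Beta (\<pi> + real (m 1)) (\<nu> + real ?M)"
      using set_borel_integral_eq_integral(2)[OF integrable_Beta[OF p]] has_integral_Beta_real[OF p]
      by (simp add: integral_unique)
    then show ?thesis by (simp only: set_integral_mult_right)
  qed
  also have "\<dots> = (\<Prod>j=2..K. ?b j ^ m j) * (Beta (\<pi> + real (m 1)) (\<nu> + real ?M) / Beta \<pi> \<nu>)" by simp
  finally show ?thesis unfolding F_def Beta_ratio[OF pos] .
qed

section \<open>HLS sequences as urn processes\<close>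

text \<open>Grouping a word by colours turns its probability into the moment computed above:
  \<open>m 1\<close> counts \<open>d 1\<close>, and the other counts add up to the second Pochhammer
  index. The function \<open>inv_into\<close> carries the weights from indices to colours.\<close>

lemma HLS_urn_process:
  assumes K: "K \<ge> 3" and inj: "inj_on d {1..K}" and D: "D = d ` {1..K}"
    and pos: "\<pi> > 0" "\<nu> > 0"
    and \<alpha>: "\<And>i. i \<in> {1..K-2} \<Longrightarrow> \<alpha> i > 0" and sum_\<alpha>: "(\<Sum>i=1..K-2. \<alpha> i) < 1"
    and M: "prob_space M" and X: "\<And>n. n \<ge> 1 \<Longrightarrow> X n \<in> measurable M (count_space D)"
    and deF: "de_Finetti_measure M K d X (HLS_measure K \<pi> \<nu> \<alpha>)"
  shows "urn_process D (d 1) (\<lambda>c. simplex_color_weight K \<alpha> (inv_into {1..K} d c)) \<pi> \<nu> M X"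
proof -
  let ?b = "simplex_color_weight K \<alpha>"
  let ?B = "\<lambda>c. ?b (inv_into {1..K} d c)"
  have B: "?B (d j) = ?b j" if "j \<in> {1..K}" for j
    using that inj by (simp add: inv_into_f_f)
  have img: "D - {d 1} = d ` {2..K}"
  proof -
    have "{1..K} - {1} = {2..K}" by auto
    then show ?thesis
      using inj_on_image_set_diff[OF inj, of "{1..K}" "{1}"] K unfolding D by simp
  qed
  have inj2: "inj_on d {2..K}" using inj by (rule inj_on_subset) auto
  have one: "1 \<in> {1..K}" using K by auto
  interpret two_stage_urn D "d 1" ?B \<pi> \<nu>
  proof
    show "finite D" "d 1 \<in> D" using D one by auto
    show "?B (d 1) = 1" unfolding B[OF one] by (simp add: simplex_color_weight_def)
    show "\<pi> > 0" "\<nu> > 0" by fact+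
    have "(\<Sum>c\<in>D - {d 1}. ?B c) = (\<Sum>j=2..K. ?B (d j))"
      unfolding img using inj2 by (simp add: sum.reindex)
    also have "\<dots> = (\<Sum>j=2..K. ?b j)" using B by (intro sum.cong) auto
    finally show "(\<Sum>c\<in>D - {d 1}. ?B c) = 1" using sum_simplex_color_weight[OF K] by simp
    fix c assume "c \<in> D"
    then obtain j where j: "j \<in> {1..K}" "c = d j" using D by auto
    show "?B c > 0"
      unfolding j(2) B[OF j(1)] using j(1) sum_\<alpha>
      by (auto simp: simplex_color_weight_def intro!: \<alpha>)
  qed
  interpret prob_space M by (rule M)
  show ?thesis
  proof
    show "X n \<in> measurable M (count_space D)" if "n \<ge> 1" for n by (rule X[OF that])
    fix n :: nat and xs assume n: "n \<ge> 1" and xs: "xs \<in> tuples D n"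
    define m where "m j = count (mset xs) (d j)" for j
    have sub: "set_mset (mset xs) \<subseteq> D" using xs by (simp add: tuples_def)
    have finD: "finite D" using D by simp
    have sz: "size (mset xs) = m 1 + (\<Sum>j=2..K. m j)"
    proof -
      have "size (mset xs) = (\<Sum>c\<in>D. count (mset xs) c)"
        unfolding size_multiset_overloaded_eq
        using sub finD by (intro sum.mono_neutral_left) (auto simp: count_eq_zero_iff)
      also have "\<dots> = count (mset xs) (d 1) + (\<Sum>c\<in>D - {d 1}. count (mset xs) c)"
        using finD D one by (intro sum.remove) auto
      finally show ?thesis unfolding img m_def using inj2 by (simp add: sum.reindex)
    qed
    have pr: "(\<Prod>c\<in>#mset xs. ?B c) = (\<Prod>j=2..K. ?b j ^ m j)"
    proof -
      have "(\<Prod>c\<in>#mset xs. ?B c) = (\<Prod>c\<in>D. ?B c ^ count (mset xs) c)"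
        unfolding image_prod_mset_multiplicity
        using sub finD by (intro prod.mono_neutral_left) (auto simp: count_mset count_list_0_iff)
      also have "\<dots> = ?B (d 1) ^ count (mset xs) (d 1) * (\<Prod>c\<in>D - {d 1}. ?B c ^ count (mset xs) c)"
        using finD D one by (intro prod.remove) auto
      also have "?B (d 1) = 1" unfolding B[OF one] by (simp add: simplex_color_weight_def)
      also have "(\<Prod>c\<in>D - {d 1}. ?B c ^ count (mset xs) c) = (\<Prod>j=2..K. ?B (d j) ^ m j)"
        unfolding img m_def using inj2 by (simp add: prod.reindex)
      also have "\<dots> = (\<Prod>j=2..K. ?b j ^ m j)" using B by (intro prod.cong) auto
      finally show ?thesis by simp
    qed
    have "measure M {\<omega>\<in>space M. block X 1 n \<omega> = xs} =
        (\<integral>\<theta>. (\<Prod>j=1..K-1. \<theta> j ^ m j) * (1 - (\<Sum>h=1..K-1. \<theta> h)) ^ m K \<partial>HLS_measure K \<pi> \<nu> \<alpha>)"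
      using deF n xs unfolding de_Finetti_measure_def D m_def count_mset by blast
    also have "\<dots> = (\<Prod>j=2..K. ?b j ^ m j) * (pochhammer \<pi> (m 1) * pochhammer \<nu> (\<Sum>j=2..K. m j)
        / pochhammer (\<pi> + \<nu>) (m 1 + (\<Sum>j=2..K. m j)))"
      using K pos \<alpha> sum_\<alpha> by (rule integral_HLS_measure)
    also have "\<dots> = weight (mset xs)"
      unfolding weight_def pr sz m_def[symmetric] by simp
    finally show "measure M {\<omega>\<in>space M. block X 1 n \<omega> = xs} = weight (mset xs)" .
  qed
qed


section \<open>Comparison with Dirichlet measures\<close>

lemma Theta_coordinates_le_one:
  assumes "\<theta> \<in> Theta K" "h \<in> {1..K-1}"
  shows "0 \<le> \<theta> h" "\<theta> h \<le> 1"
proof -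
  show "0 \<le> \<theta> h" using assms by (simp add: Theta_def)
  have "\<theta> h \<le> (\<Sum>h=1..K-1. \<theta> h)"
    using assms by (intro member_le_sum) (auto simp: Theta_def)
  then show "\<theta> h \<le> 1" using assms by (simp add: Theta_def)
qed

lemma sets_Theta: "Theta K \<in> sets (PiM {1..K-1} (\<lambda>_. borel))"
proof -
  let ?P = "PiM {1..K-1} (\<lambda>_. borel :: real measure)"
  have m: "(\<lambda>\<theta>. \<theta> h) \<in> borel_measurable ?P" if "h \<in> {1..K-1}" for h
    using that by (rule measurable_component_singleton)
  have "Theta K = {\<theta>\<in>space ?P. (\<forall>h\<in>{1..K-1}. 0 \<le> \<theta> h) \<and> (\<Sum>h=1..K-1. \<theta> h) \<le> 1}"
    by (auto simp: Theta_def space_PiM)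
  also have "\<dots> \<in> sets ?P"
    using m by (intro sets.sets_Collect_conj sets.sets_Collect_finite_All borel_measurable_le
        borel_measurable_sum borel_measurable_const) auto
  finally show ?thesis .
qed

text \<open>Integrating over the coordinate \<open>i\<close> first, each section of the hyperplane
  has at most one point and hence measure 0.\<close>

lemma AE_PiM_lborel_not_hyperplane:
  fixes I :: "nat set" and a b :: real
  assumes "finite I" "i \<in> I" "j \<in> I" "i \<noteq> j"
  shows "AE \<theta> in PiM I (\<lambda>_. lborel). \<theta> i \<noteq> a + b * \<theta> j"
proof -
  interpret product_sigma_finite "\<lambda>_::nat. lborel :: real measure" ..
  let ?P = "PiM I (\<lambda>_. lborel :: real measure)"
  define J where "J = I - {i}"
  have I: "I = insert i J" "i \<notin> J" and J: "finite J" "j \<in> J" using assms by (auto simp: J_def)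
  define H where "H = {\<theta>\<in>space ?P. \<theta> i = a + b * \<theta> j}"
  have [measurable]: "(\<lambda>\<theta>. \<theta> i) \<in> borel_measurable ?P" "(\<lambda>\<theta>. \<theta> j) \<in> borel_measurable ?P"
    using measurable_component_singleton[of _ I "\<lambda>_. lborel :: real measure"] assms(2,3) by auto
  have H: "H \<in> sets ?P" unfolding H_def by measurable
  have "emeasure ?P H = (\<integral>\<^sup>+\<theta>. indicator H \<theta> \<partial>?P)" using H by simp
  also have "\<dots> = (\<integral>\<^sup>+x. \<integral>\<^sup>+y. indicator H (x(i := y)) \<partial>lborel \<partial>PiM J (\<lambda>_. lborel :: real measure))"
    using H unfolding I(1) by (intro product_nn_integral_insert J I(2)) auto
  also have "\<dots> = (\<integral>\<^sup>+x. 0 \<partial>PiM J (\<lambda>_. lborel :: real measure))"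
  proof (rule nn_integral_cong)
    fix x :: "nat \<Rightarrow> real"
    have "(\<integral>\<^sup>+y. indicator H (x(i := y)) \<partial>lborel) \<le> (\<integral>\<^sup>+y. indicator {a + b * x j} y \<partial>lborel)"
      using assms(4) by (intro nn_integral_mono) (auto simp: H_def indicator_def)
    then show "(\<integral>\<^sup>+y. indicator H (x(i := y)) \<partial>lborel) = 0" by simp
  qed
  finally have "H \<in> null_sets ?P" using H by (simp add: null_sets_def)
  then have "AE \<theta> in ?P. \<theta> \<notin> H" by (rule AE_not_in)
  then show ?thesis using AE_space by eventually_elim (simp add: H_def)
qed

lemma AE_Dirichlet_not_hyperplane:
  assumes "i \<in> {1..K-1}" "j \<in> {1..K-1}" "i \<noteq> j"
  shows "AE \<theta> in Dirichlet_measure K a. \<theta> i \<noteq> p + q * \<theta> j"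
proof -
  have sets: "sets (PiM {1..K-1} (\<lambda>_. lborel :: real measure)) = sets (PiM {1..K-1} (\<lambda>_. borel))"
    by (intro sets_PiM_cong) auto
  have m: "(\<lambda>\<theta>. \<theta> h) \<in> borel_measurable (Theta_lborel K)" if "h \<in> {1..K-1}" for h
    unfolding Theta_lborel_def using measurable_component_singleton[OF that, of "\<lambda>_. lborel :: real measure"]
    by (intro measurable_restrict_space1) simp
  have dens: "(\<lambda>\<theta>. ennreal (Gamma (\<Sum>j=1..K. a j) / (\<Prod>j=1..K. Gamma (a j)) *
      (\<Prod>j=1..K-1. \<theta> j powr (a j - 1)) * (1 - (\<Sum>h=1..K-1. \<theta> h)) powr (a K - 1)))
      \<in> borel_measurable (Theta_lborel K)"
    using m by (intro measurable_compose[OF _ measurable_ennreal] borel_measurable_times borel_measurable_prod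
        powr_real_measurable borel_measurable_diff borel_measurable_sum borel_measurable_const) auto
  have "Theta K \<inter> space (PiM {1..K-1} (\<lambda>_. lborel)) \<in> sets (PiM {1..K-1} (\<lambda>_. lborel :: real measure))"
    unfolding sets using sets_Theta[of K] sets.Int_space_eq2[OF sets_Theta[of K]]
    by (simp add: sets_eq_imp_space_eq[OF sets])
  then have "AE \<theta> in Theta_lborel K. \<theta> i \<noteq> p + q * \<theta> j"
    unfolding Theta_lborel_def using AE_PiM_lborel_not_hyperplane[of "{1..K-1}" i j p q] assms
    by (subst AE_restrict_space_iff) auto
  then show ?thesis
    unfolding Dirichlet_measure_def by (subst AE_density[OF dens]) auto
qed

text \<open>
  The moments of order two of \<open>\<theta>\<^sub>1\<close> and \<open>\<theta>\<^sub>2\<close> are probabilities of words, so every representing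
  measure gives \<open>(\<theta>\<^sub>2 - \<alpha>\<^sub>1 (1 - \<theta>\<^sub>1))\<^sup>2\<close> the integral that the HLS measure gives it, namely \<open>0\<close>.
\<close>

lemma HLS_AE_hyperplane:
  assumes K: "K \<ge> 3" and inj: "inj_on d {1..K}" and D: "D = d ` {1..K}"
    and urn: "urn_process D (d 1) (\<lambda>c. simplex_color_weight K \<alpha> (inv_into {1..K} d c)) \<pi> \<nu> M X"
    and deF: "de_Finetti_measure M K d X \<gamma>"
  shows "AE \<theta> in \<gamma>. \<theta> 2 = \<alpha> 1 + (- \<alpha> 1) * \<theta> 1"
proof -
  interpret urn_process D "d 1" "\<lambda>c. simplex_color_weight K \<alpha> (inv_into {1..K} d c)" \<pi> \<nu> M X
    by (rule urn)
  interpret \<gamma>: prob_space \<gamma> using deF by (simp add: de_Finetti_measure_def)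
  have sets_\<gamma>: "sets \<gamma> = sets (Theta_borel K)" using deF by (simp add: de_Finetti_measure_def)
  have space_\<gamma>: "space \<gamma> = Theta K"
    using sets_eq_imp_space_eq[OF sets_\<gamma>] sets.sets_into_space[OF sets_Theta[of K]]
    by (auto simp: Theta_borel_def space_restrict_space)
  have idx: "1 \<in> {1..K-1}" "2 \<in> {1..K-1}" "2 \<in> {1..K}" "1 \<in> {1..K}" "K \<in> {1..K}" using K by auto
  have d12: "d 1 \<noteq> d 2" using inj_onD[OF inj, of 1 2] idx by auto
  have meas: "(\<lambda>\<theta>. \<theta> h) \<in> borel_measurable \<gamma>" if "h \<in> {1..K-1}" for h
    using measurable_Theta_borel_component[OF that] measurable_cong_sets[OF sets_\<gamma> refl] by blast
  define P where "P i j = \<alpha> 1 ^ j * (pochhammer \<pi> i * pochhammer \<nu> j / pochhammer (\<pi> + \<nu>) (i + j))" for i j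
  have moment: "has_bochner_integral \<gamma> (\<lambda>\<theta>. \<theta> 1 ^ i * \<theta> 2 ^ j) (P i j)" if ij: "i + j \<ge> 1" for i j
  proof -
    \<comment> \<open>The probability of \<open>i\<close> copies of \<open>d 1\<close> followed by
      \<open>j\<close> copies of \<open>d 2\<close> is the mixed moment of orders \<open>i\<close>
      and \<open>j\<close>.\<close>
    define xs where "xs = replicate i (d 1) @ replicate j (d 2)"
    have xs: "xs \<in> tuples (d ` {1..K}) (i + j)" using idx by (auto simp: xs_def tuples_def)
    have cnt: "count_list xs (d h) = (if h = 1 then i else if h = 2 then j else 0)" if "h \<in> {1..K}" for h
    proof -
      have "d h = d 1 \<longleftrightarrow> h = 1" "d h = d 2 \<longleftrightarrow> h = 2"
        using inj_on_eq_iff[OF inj that] idx by auto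
      then show ?thesis using d12 by (auto simp: xs_def count_mset[symmetric])
    qed
    have "(\<Prod>h=1..K-1. \<theta> h ^ count_list xs (d h)) * (1 - (\<Sum>h=1..K-1. \<theta> h)) ^ count_list xs (d K) =
        \<theta> 1 ^ i * \<theta> 2 ^ j" for \<theta> :: "nat \<Rightarrow> real"
    proof -
      have "(\<Prod>h=1..K-1. \<theta> h ^ count_list xs (d h)) = (\<Prod>h\<in>{1,2}. \<theta> h ^ count_list xs (d h))"
        using cnt idx by (intro prod.mono_neutral_right) (auto split: if_splits)
      then show ?thesis using cnt[OF idx(4)] cnt[OF idx(3)] cnt[OF idx(5)] K by simp
    qed
    then have "(\<integral>\<theta>. \<theta> 1 ^ i * \<theta> 2 ^ j \<partial>\<gamma>) = measure M {\<omega>\<in>space M. block X 1 (i + j) \<omega> = xs}"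
      using deF ij xs unfolding de_Finetti_measure_def by simp
    also have "\<dots> = weight (mset xs)" using law[OF ij] xs unfolding D by blast
    also have "\<dots> = P i j"
    proof -
      have "(\<Prod>c\<in>#mset xs. simplex_color_weight K \<alpha> (inv_into {1..K} d c)) = \<alpha> 1 ^ j"
        using inv_into_f_f[OF inj idx(4)] inv_into_f_f[OF inj idx(3)] K
        by (simp add: xs_def simplex_color_weight_def)
      moreover have "count (mset xs) (d 1) = i" using cnt[OF idx(4)] by (simp add: count_mset)
      moreover have "size (mset xs) = i + j" by (simp add: xs_def)
      ultimately show ?thesis unfolding weight_def P_def by simp
    qed
    finally have "(\<integral>\<theta>. \<theta> 1 ^ i * \<theta> 2 ^ j \<partial>\<gamma>) = P i j" .
    moreover have "integrable \<gamma> (\<lambda>\<theta>. \<theta> 1 ^ i * \<theta> 2 ^ j)"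
    proof (rule \<gamma>.integrable_const_bound[where B = 1])
      show "AE \<theta> in \<gamma>. norm (\<theta> 1 ^ i * \<theta> 2 ^ j) \<le> 1"
        using AE_space
      proof eventually_elim
        case (elim \<theta>)
        then have "0 \<le> \<theta> 1" "\<theta> 1 \<le> 1" "0 \<le> \<theta> 2" "\<theta> 2 \<le> 1"
          using Theta_coordinates_le_one idx space_\<gamma> by auto
        then show ?case by (simp add: abs_mult mult_le_one power_le_one)
      qed
      show "(\<lambda>\<theta>. \<theta> 1 ^ i * \<theta> 2 ^ j) \<in> borel_measurable \<gamma>"
        using meas idx by (intro borel_measurable_times borel_measurable_power) auto
    qed
    ultimately show ?thesis using has_bochner_integral_integrable by fastforce
  qed
  define q where "q \<theta> = (\<theta> 2 - \<alpha> 1 * (1 - \<theta> 1))\<^sup>2" for \<theta> :: "nat \<Rightarrow> real"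
  let ?a = "\<alpha> 1"
  \<comment> \<open>This is the square \<open>q\<close> expanded into monomials. Words have length
    at least 1, so the constant term is not a \<open>moment\<close>; it comes from the total mass 1
    of \<open>\<gamma>\<close>.\<close>
  have "has_bochner_integral \<gamma> (\<lambda>\<theta>. \<theta> 1 ^ 0 * \<theta> 2 ^ 2 + (- 2 * ?a) * (\<theta> 1 ^ 0 * \<theta> 2 ^ 1)
      + 2 * ?a * (\<theta> 1 ^ 1 * \<theta> 2 ^ 1) + ?a\<^sup>2 + (- 2 * ?a\<^sup>2) * (\<theta> 1 ^ 1 * \<theta> 2 ^ 0) + ?a\<^sup>2 * (\<theta> 1 ^ 2 * \<theta> 2 ^ 0))
    (P 0 2 + (- 2 * ?a) * P 0 1 + 2 * ?a * P 1 1 + ?a\<^sup>2 + (- 2 * ?a\<^sup>2) * P 1 0 + ?a\<^sup>2 * P 2 0)"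
    (is "has_bochner_integral \<gamma> ?f ?v")
  proof -
    have "has_bochner_integral \<gamma> (\<lambda>_. ?a\<^sup>2) (?a\<^sup>2)"
      using has_bochner_integral_integrable[OF \<gamma>.integrable_const[of "?a\<^sup>2"]] \<gamma>.prob_space by simp
    then show ?thesis
      by (intro has_bochner_integral_add has_bochner_integral_mult_right moment) auto
  qed
  moreover have "?f = q"
    by (rule ext) (simp add: q_def power2_eq_square algebra_simps)
  moreover have "?v = 0"
  proof -
    have "\<pi> + \<nu> > 0" "\<pi> + \<nu> + 1 > 0" using pi_pos nu_pos by simp_all
    then show ?thesis
      by (simp add: P_def pochhammer_Suc numeral_2_eq_2 divide_simps) (simp add: algebra_simps)
  qed
  ultimately have q: "has_bochner_integral \<gamma> q 0" by simp
  have "AE \<theta> in \<gamma>. q \<theta> = 0"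
    using integral_nonneg_eq_0_iff_AE[of \<gamma> q] q by (simp add: has_bochner_integral_iff q_def)
  then show ?thesis by eventually_elim (simp add: q_def algebra_simps)
qed

lemma HLS_not_Polya:
  assumes K: "K \<ge> 3" and "inj_on d {1..K}" and "D = d ` {1..K}"
    and "urn_process D (d 1) (\<lambda>c. simplex_color_weight K \<alpha> (inv_into {1..K} d c)) \<pi> \<nu> M X"
  shows "\<not> Polya_sequence M K d X"
proof
  assume "Polya_sequence M K d X"
  then obtain a where deF: "de_Finetti_measure M K d X (Dirichlet_measure K a)"
    by (auto simp: Polya_sequence_def)
  interpret prob_space "Dirichlet_measure K a" using deF by (simp add: de_Finetti_measure_def)
  have "AE \<theta> in Dirichlet_measure K a. \<theta> 2 \<noteq> \<alpha> 1 + (- \<alpha> 1) * \<theta> 1"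
    using K by (intro AE_Dirichlet_not_hyperplane) auto
  moreover have "AE \<theta> in Dirichlet_measure K a. \<theta> 2 = \<alpha> 1 + (- \<alpha> 1) * \<theta> 1"
    using HLS_AE_hyperplane[OF assms deF] .
  ultimately have "AE \<theta> in Dirichlet_measure K a. False"
    by eventually_elim simp
  then show False by simp
qed

theorem theorem2p3:
  fixes M :: "'w measure"
    and X :: "nat \<Rightarrow> 'w \<Rightarrow> 'd"
    and d :: "nat \<Rightarrow> 'd"
    and D :: "'d set"
    and K :: nat
    and \<pi> \<nu> :: real
    and \<alpha> :: "nat \<Rightarrow> real"
  assumes "K \<ge> 3"
    and "inj_on d {1..K}"
    and "D = d ` {1..K}"
    and "\<pi> > 0" and "\<nu> > 0"
    and "\<And>i. i \<in> {1..K-2} \<Longrightarrow> \<alpha> i > 0"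
    and "(\<Sum>i=1..K-2. \<alpha> i) < 1"
    and "prob_space M"
    and "\<And>n. n \<ge> 1 \<Longrightarrow> X n \<in> measurable M (count_space D)"
    and "HLS_sequence M K d \<pi> \<nu> \<alpha> X"
  shows "Hoeffding_decomposable M D X \<and> \<not> iid_sequence M D X \<and> \<not> Polya_sequence M K d X"
proof -
  have urn: "urn_process D (d 1) (\<lambda>c. simplex_color_weight K \<alpha> (inv_into {1..K} d c)) \<pi> \<nu> M X"
    using assms(1-9) HLS_sequence_def[THEN iffD1, OF assms(10), THEN conjunct2] by (rule HLS_urn_process)
  then interpret urn_process D "d 1" "\<lambda>c. simplex_color_weight K \<alpha> (inv_into {1..K} d c)" \<pi> \<nu> M X .
  show ?thesis
    using hoeffding_decomposable not_iid HLS_not_Polya[OF assms(1-3) urn] by blast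
qed

end
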